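(* The image of $A_2$ under the $\mathfrak{sl}_2$ weight system $w_{\mathfrak{sl}_2}\colon A_2\to U(\mathfrak{sl}_2)\otimes U(\mathfrak{sl}_2)$ equals the subalgebra generated by $c_1=c\otimes1$, $c_2=1\otimes c$ and $x=x_1\otimes x_1+x_2\otimes x_2+x_3\otimes x_3$, and these three elements are algebraically independent over $\mathbb C$; i.e. $\operatorname{Im} w_{\mathfrak{sl}_2}=\mathbb C[c_1,c_2,x]$ is a polynomial ring in $c_1,c_2,x$.
   Context: $x_1=\tfrac12\begin{pmatrix}0&1\\1&0\end{pmatrix}$, $x_2=\tfrac12\begin{pmatrix}0&-i\\ i&0\end{pmatrix}$, $x_3=\tfrac12\begin{pmatrix}1&0\\0&-1\end{pmatrix}$ is a basis of $\mathfrak{sl}_2(\mathbb C)$ orthonormal for $(a,b)=2\operatorname{tr}(ab)$, and $c=x_1^2+x_2^2+x_3^2\in U(\mathfrak{sl}_2)$. A chord diagram on two strands (a share) consists of two oriented intervals, strand 1 and strand 2, and finitely many chords, i.e. pairwise disjoint pairs of points of their union (all points distinct), up to orientation-preserving diffeomorphisms of each strand. $A_2$ is the $\mathbb C$-vector space spanned by shares, an algebra under concatenation (strand $i$ of the product is strand $i$ of the first factor followed by strand $i$ of the second). For a share $I$, $w_{\mathfrak{sl}_2}(I)=\sum_{\varphi}P_1^\varphi\otimes P_2^\varphi$, where $\varphi$ runs over maps from the chords to $\{1,2,3\}$ and $P_j^\varphi\in U(\mathfrak{sl}_2)$ is the product, in the order along strand $j$, of $x_{\varphi(\text{chord of }p)}$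 over the chord endpoints $p$ on strand $j$ (empty product $=1$); $w_{\mathfrak{sl}_2}$ is extended linearly. *)

theory Defs
  imports Complex_Main "HOL-Library.FuncSet"
begin

type_synonym mat2 = "nat \<Rightarrow> nat \<Rightarrow> complex"  (* indices 0,1 *)

definition sl2x :: "nat \<Rightarrow> mat2" where
  "sl2x a = (\<lambda>r s.
     if a = 1 then (if r \<noteq> s then 1/2 else 0)
     else if a = 2 then (if r = 0 \<and> s = 1 then - \<i>/2 else if r = 1 \<and> s = 0 then \<i>/2 else 0)
     else if a = 3 then (if r = 0 \<and> s = 0 then 1/2 else if r = 1 \<and> s = 1 then -1/2 else 0)
     else 0)"

definition mmul2 :: "mat2 \<Rightarrow> mat2 \<Rightarrow> mat2" where
  "mmul2 A B = (\<lambda>r s. \<Sum>k<2. A r k * B k s)"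

definition mtr2 :: "mat2 \<Rightarrow> complex" where
  "mtr2 A = (\<Sum>k<2. A k k)"

definition sl2_form :: "mat2 \<Rightarrow> mat2 \<Rightarrow> complex" where
  "sl2_form A B = 2 * mtr2 (mmul2 A B)"

text \<open>Structure constants: [x_a,x_b] = sum_c (([x_a,x_b], x_c)) x_c (the basis is orthonormal).\<close>
definition sl2_struct :: "nat \<Rightarrow> nat \<Rightarrow> nat \<Rightarrow> complex" where
  "sl2_struct a b c =
     sl2_form (\<lambda>r s. mmul2 (sl2x a) (sl2x b) r s - mmul2 (sl2x b) (sl2x a) r s) (sl2x c)"

text \<open>A letter (j,a) with j in {1,2}, a in {1,2,3} stands for x_a placed in tensor factor j,
  i.e. x_a \<otimes> 1 (j = 1) or 1 \<otimes> x_a (j = 2).  Elements of the free algebra are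
  coefficient functions on words.\<close>

type_synonym letter = "nat \<times> nat"
type_synonym felem = "letter list \<Rightarrow> complex"

definition letters :: "letter set" where
  "letters = {1,2} \<times> {1,2,3}"

definition fa_word :: "letter list \<Rightarrow> felem" where
  "fa_word v = (\<lambda>u. if u = v then 1 else 0)"

definition fa_zero :: felem where
  "fa_zero = (\<lambda>_. 0)"

definition fa_add :: "felem \<Rightarrow> felem \<Rightarrow> felem" where
  "fa_add f g = (\<lambda>w. f w + g w)"

definition fa_smult :: "complex \<Rightarrow> felem \<Rightarrow> felem" where
  "fa_smult c f = (\<lambda>w. c * f w)"

definition fa_mult :: "felem \<Rightarrow> felem \<Rightarrow> felem" where
  "fa_mult f g = (\<lambda>w. \<Sum>k\<le>length w. f (take k w) * g (drop k w))"

primrec fa_pow :: "felem \<Rightarrow> nat \<Rightarrow> felem" where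
  "fa_pow f 0 = fa_word []"
| "fa_pow f (Suc n) = fa_mult f (fa_pow f n)"

definition U_rel :: "letter \<Rightarrow> letter \<Rightarrow> felem" where
  "U_rel p q = (\<lambda>w. fa_word [p, q] w - fa_word [q, p] w
      - (if fst p = fst q
         then (\<Sum>c\<in>{1,2,3}. sl2_struct (snd p) (snd q) c * fa_word [(fst p, c)] w)
         else 0))"

inductive_set U_ideal :: "felem set" where
  zero: "fa_zero \<in> U_ideal"
| gen: "\<lbrakk>p \<in> letters; q \<in> letters; set u \<subseteq> letters; set v \<subseteq> letters\<rbrakk>
          \<Longrightarrow> fa_mult (fa_mult (fa_word u) (U_rel p q)) (fa_word v) \<in> U_ideal"
| add: "\<lbrakk>f \<in> U_ideal; g \<in> U_ideal\<rbrakk> \<Longrightarrow> fa_add f g \<in> U_ideal"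
| smult: "f \<in> U_ideal \<Longrightarrow> fa_smult c f \<in> U_ideal"

text \<open>Equality in U(sl_2) \<otimes> U(sl_2).\<close>
definition uequiv :: "felem \<Rightarrow> felem \<Rightarrow> bool" where
  "uequiv f g \<longleftrightarrow> (\<lambda>w. f w - g w) \<in> U_ideal"

text \<open>A share is encoded by the sequences of chord labels met along strand 1 and along
  strand 2; every chord label occurs exactly twice in total (its two endpoints).\<close>
definition is_share :: "nat list \<times> nat list \<Rightarrow> bool" where
  "is_share S \<longleftrightarrow> (\<forall>k \<in> set (fst S @ snd S). count_list (fst S @ snd S) k = 2)"

text \<open>w(S) = sum over phi : chords \<rightarrow> {1,2,3} of P_1 \<otimes> P_2 = (P_1 \<otimes> 1)(1 \<otimes> P_2).\<close>
definition w_sl2 :: "nat list \<times> nat list \<Rightarrow> felem" where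
  "w_sl2 S = (\<lambda>w. \<Sum>\<phi> \<in> (set (fst S @ snd S) \<rightarrow>\<^sub>E {1,2,3}).
       fa_word (map (\<lambda>k. (1, \<phi> k)) (fst S) @ map (\<lambda>k. (2, \<phi> k)) (snd S)) w)"

text \<open>f (mod the ideal) lies in the image of the linear extension of w to A_2.\<close>
definition in_w_image :: "felem \<Rightarrow> bool" where
  "in_w_image f \<longleftrightarrow> (\<exists>L :: (complex \<times> (nat list \<times> nat list)) list.
      (\<forall>(c, S) \<in> set L. is_share S) \<and>
      uequiv f (\<lambda>w. \<Sum>(c, S) \<leftarrow> L. c * w_sl2 S w))"

definition cas1 :: felem where
  "cas1 = (\<lambda>w. \<Sum>i\<in>{1,2,3}. fa_word [(1, i), (1, i)] w)"

definition cas2 :: felem where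
  "cas2 = (\<lambda>w. \<Sum>i\<in>{1,2,3}. fa_word [(2, i), (2, i)] w)"

definition xel :: felem where
  "xel = (\<lambda>w. \<Sum>i\<in>{1,2,3}. fa_word [(1, i), (2, i)] w)"

inductive_set gen_alg :: "felem set" where
  one: "fa_word [] \<in> gen_alg"
| c1: "cas1 \<in> gen_alg"
| c2: "cas2 \<in> gen_alg"
| x: "xel \<in> gen_alg"
| add: "\<lbrakk>f \<in> gen_alg; g \<in> gen_alg\<rbrakk> \<Longrightarrow> fa_add f g \<in> gen_alg"
| smult: "f \<in> gen_alg \<Longrightarrow> fa_smult c f \<in> gen_alg"
| mult: "\<lbrakk>f \<in> gen_alg; g \<in> gen_alg\<rbrakk> \<Longrightarrow> fa_mult f g \<in> gen_alg"

text \<open>Evaluation of a commutative polynomial in three variables (finitely supported coefficient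
  function on exponent triples) at (c_1, c_2, x).\<close>
definition monom3 :: "nat \<times> nat \<times> nat \<Rightarrow> felem" where
  "monom3 m = (case m of (a, b, c) \<Rightarrow>
      fa_mult (fa_pow cas1 a) (fa_mult (fa_pow cas2 b) (fa_pow xel c)))"

definition eval3 :: "(nat \<times> nat \<times> nat \<Rightarrow> complex) \<Rightarrow> felem" where
  "eval3 p = (\<lambda>w. \<Sum>m \<in> {m. p m \<noteq> 0}. p m * monom3 m w)"

end

theory Submission
  imports Defs
begin

text \<open>
  Contracting a word of letters with a tensor built from Kronecker deltas and Levi-Civita symbols gives
  a span that contains all values of the weight system and is closed under commutators: exchanging two
  neighbouring letters costs a shorter word contracted with a tensor of the same kind. Hence, modulo
  shorter words, the order of the letters is irrelevant. If the tensor contains a Levi-Civita symbol,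
  two of its three letters lie on the same strand and antisymmetry kills the leading term; otherwise a
  delta splits off one of the generators. By induction on the length everything is a polynomial in
  c_1, c_2, x. Conversely, multiplying a share by a generator prepends one chord.

  For independence, let the algebra act on the tensor product of two dual Verma modules with highest
  weights l_1, l_2. There c_1 and c_2 act by l_1(l_1+2)/4 and l_2(l_2+2)/4, and x has, on the singular
  vector of degree k, an eigenvalue quadratic in k. A polynomial relation therefore holds
  for all values of the first two variables and infinitely many values of the third.
\<close>

section \<open>The free algebra\<close>

text \<open>Chords alone produce only Kronecker symbols. Levi-Civita symbols enter through the
  commutators, because the structure constants in this orthonormal basis are
  \<open>\<i> * eps a b c\<close>; the span stays closed because two Levi-Civita symbols that share
  an index contract back to Kronecker symbols. The bookkeeping rests on the commutator reusing one
  of its two labels, so that each label of the shorter word again occurs exactly once. In the second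
  half, finite-dimensional modules would give only discrete highest weights. With free complex
  weights \<open>l1\<close> and \<open>l2\<close> both Casimir values run through all complex
  numbers. The dual of a Verma module is chosen because e then merely shifts coefficients: the
  equation for a singular vector of the tensor product does not contain the weights, its solution
  has coefficients 1 and -1, and there are no denominators that vanish for special weights.\<close>

lemma fa_mult_word_left:
  "fa_mult (fa_word u) f w = (if take (length u) w = u then f (drop (length u) w) else 0)"
proof (cases "take (length u) w = u")
  case True
  then have le: "length u \<le> length w"
    by (metis append_take_drop_id length_append le_add1)
  have zero: "fa_word u (take k w) = 0" if "k \<le> length w" "k \<noteq> length u" for k
    using that by (auto simp: fa_word_def)
  have "(\<Sum>k\<le>length w. fa_word u (take k w) * f (drop k w))
      = (\<Sum>k\<in>{length u}. fa_word u (take k w) * f (drop k w))"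
    using le zero by (intro sum.mono_neutral_right) auto
  with True show ?thesis by (simp add: fa_mult_def fa_word_def)
next
  case False
  then have "fa_word u (take k w) = 0" if "k \<le> length w" for k
    using that by (auto simp: fa_word_def)
  with False show ?thesis by (simp add: fa_mult_def)
qed

lemma fa_mult_word_word: "fa_mult (fa_word u) (fa_word v) = fa_word (u @ v)"
proof
  fix w
  show "fa_mult (fa_word u) (fa_word v) w = fa_word (u @ v) w"
    unfolding fa_mult_word_left by (auto simp: fa_word_def) (metis append_take_drop_id)+
qed

lemma fa_mult_one_left: "fa_mult (fa_word []) f = f"
  by (rule ext) (simp add: fa_mult_word_left)

lemma fa_mult_one_right: "fa_mult f (fa_word []) = f"
proof
  fix w
  have "(\<Sum>k\<le>length w. f (take k w) * fa_word [] (drop k w))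
      = (\<Sum>k\<in>{length w}. f (take k w) * fa_word [] (drop k w))"
    by (intro sum.mono_neutral_right) (auto simp: fa_word_def)
  then show "fa_mult f (fa_word []) w = f w" by (simp add: fa_mult_def fa_word_def)
qed

lemma fa_mult_sum_left:
  "fa_mult (\<lambda>w. \<Sum>i\<in>A. f i w) g = (\<lambda>w. \<Sum>i\<in>A. fa_mult (f i) g w)"
  by (rule ext) (simp add: fa_mult_def sum_distrib_right sum.swap[of _ A])

lemma fa_mult_sum_right:
  "fa_mult g (\<lambda>w. \<Sum>i\<in>A. f i w) = (\<lambda>w. \<Sum>i\<in>A. fa_mult g (f i) w)"
  by (rule ext) (simp add: fa_mult_def sum_distrib_left sum.swap[of _ A])

lemma fa_mult_scale_left: "fa_mult (\<lambda>w. c * f w) g = (\<lambda>w. c * fa_mult f g w)"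
  by (rule ext) (simp add: fa_mult_def sum_distrib_left mult.assoc)

lemma fa_mult_scale_right: "fa_mult g (\<lambda>w. c * f w) = (\<lambda>w. c * fa_mult g f w)"
  by (rule ext) (simp add: fa_mult_def sum_distrib_left mult.left_commute)

lemma fa_mult_add_left: "fa_mult (\<lambda>w. f w + g w) h = (\<lambda>w. fa_mult f h w + fa_mult g h w)"
  by (rule ext) (simp add: fa_mult_def sum.distrib ring_distribs)

lemma fa_mult_add_right: "fa_mult h (\<lambda>w. f w + g w) = (\<lambda>w. fa_mult h f w + fa_mult h g w)"
  by (rule ext) (simp add: fa_mult_def sum.distrib ring_distribs)

lemma fa_mult_diff_left: "fa_mult (\<lambda>w. f w - g w) h = (\<lambda>w. fa_mult f h w - fa_mult g h w)"
  by (rule ext) (simp add: fa_mult_def sum_subtractf ring_distribs)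

lemma fa_mult_diff_right: "fa_mult h (\<lambda>w. f w - g w) = (\<lambda>w. fa_mult h f w - fa_mult h g w)"
  by (rule ext) (simp add: fa_mult_def sum_subtractf ring_distribs)

lemma fa_mult_zero_right: "fa_mult h (\<lambda>w. 0) = (\<lambda>w. 0)"
  by (rule ext) (simp add: fa_mult_def)

lemma fa_mult_assoc: "fa_mult (fa_mult f g) h = fa_mult f (fa_mult g h)"
proof
  fix w :: "letter list"
  let ?n = "length w"
  let ?t = "\<lambda>j k. f (take j w) * g (take (k - j) (drop j w)) * h (drop k w)"
  have "fa_mult (fa_mult f g) h w = (\<Sum>k\<le>?n. \<Sum>j\<le>k. ?t j k)"
    unfolding fa_mult_def sum_distrib_right
    by (intro sum.cong refl) (auto simp: drop_take min_def)
  also have "\<dots> = (\<Sum>(k, j)\<in>Sigma {..?n} (\<lambda>k. {..k}). ?t j k)"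
    by (simp add: sum.Sigma)
  \<comment> \<open>Both bracketings run over pairs of cuts j \<le> k of the word; here the second
    cut is recorded by the length i = k - j of the middle piece.\<close>
  also have "\<dots> = (\<Sum>(j, i)\<in>Sigma {..?n} (\<lambda>j. {..?n - j}). ?t j (j + i))"
    by (rule sum.reindex_bij_witness[where i="\<lambda>(j, i). (j + i, j)" and j="\<lambda>(k, j). (j, k - j)"])
      auto
  also have "\<dots> = (\<Sum>j\<le>?n. \<Sum>i\<le>?n - j. ?t j (j + i))"
    by (simp add: sum.Sigma)
  also have "\<dots> = fa_mult f (fa_mult g h) w"
    unfolding fa_mult_def sum_distrib_left
    by (intro sum.cong refl) (auto simp: add.commute mult.assoc)
  finally show "fa_mult (fa_mult f g) h w = fa_mult f (fa_mult g h) w" .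
qed

section \<open>Structure constants, Kronecker and Levi-Civita symbols\<close>

definition ix :: "nat set" where "ix = {1, 2, 3}"

lemma finite_ix [simp]: "finite ix"
  by (simp add: ix_def)

definition eps :: "nat \<Rightarrow> nat \<Rightarrow> nat \<Rightarrow> complex" where
  "eps a b c =
    (if (a, b, c) \<in> {(1, 2, 3), (2, 3, 1), (3, 1, 2)} then 1
     else if (a, b, c) \<in> {(2, 1, 3), (3, 2, 1), (1, 3, 2)} then -1 else 0)"

text \<open>Unlike the Kronecker symbol, this vanishes outside the index set, so that the contraction identities
  need no side conditions.\<close>

definition delta :: "nat \<Rightarrow> nat \<Rightarrow> complex" where
  "delta a b = (if a = b \<and> a \<in> ix then 1 else 0)"

lemma index_cases:
  obtains "n = 1" | "n = 2" | "n = 3" | "n \<notin> {1, 2, 3 :: nat}"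
  by blast

text \<open>These are the commutation relations of the spin matrices. For an index outside 1, 2, 3
  the matrix \<open>sl2x\<close> is zero, in agreement with \<open>eps\<close>.\<close>

lemma sl2_struct_eq: "sl2_struct a b c = \<i> * eps a b c"
  by (cases a rule: index_cases; cases b rule: index_cases; cases c rule: index_cases)
    (simp_all add: sl2_struct_def sl2_form_def mtr2_def mmul2_def sl2x_def eps_def lessThan_Suc numeral_2_eq_2)

lemma eps_cyclic: "eps a b c = eps b c a"
  by (auto simp: eps_def)

lemma eps_antisym: "eps a b c = - eps b a c"
  by (auto simp: eps_def)

text \<open>The epsilon-delta identity, which keeps the span of tensors closed when two Levi-Civita
  symbols meet. It holds for all natural numbers because \<open>eps\<close> and \<open>delta\<close>
  both vanish outside \<open>ix\<close>.\<close>

lemma eps_contract: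
  "(\<Sum>i\<in>ix. eps i a b * eps i c d) = delta a c * delta b d - delta a d * delta b c"
  by (cases a rule: index_cases; cases b rule: index_cases;
      cases c rule: index_cases; cases d rule: index_cases; simp add: eps_def delta_def ix_def)

section \<open>Calculus modulo the ideal\<close>

lemma U_ideal_sum: "(\<And>i. i \<in> A \<Longrightarrow> f i \<in> U_ideal) \<Longrightarrow> (\<lambda>w. \<Sum>i\<in>A. f i w) \<in> U_ideal"
proof (induction A rule: infinite_finite_induct)
  case (insert i A)
  then show ?case
    using U_ideal.add[of "f i" "\<lambda>w. \<Sum>i\<in>A. f i w"] by (simp add: fa_add_def)
qed (use U_ideal.zero in \<open>simp_all add: fa_zero_def\<close>)

text \<open>The ideal is spanned by relations framed by words over \<open>letters\<close>, and a
  further word on the left only lengthens the frame. The left side is the one that matters, because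
  generators are split off at the front.\<close>

lemma U_ideal_mult_word:
  assumes "f \<in> U_ideal" "set u \<subseteq> letters"
  shows "fa_mult (fa_word u) f \<in> U_ideal"
  using assms(1)
proof induction
  case zero
  then show ?case using U_ideal.zero by (simp add: fa_zero_def fa_mult_zero_right)
next
  case (gen p q v v')
  then show ?case
    using U_ideal.gen[of p q "u @ v" v'] assms(2)
    by (simp add: fa_mult_assoc[symmetric] fa_mult_word_word)
next
  case (add f g)
  then show ?case using U_ideal.add by (simp add: fa_add_def fa_mult_add_right)
next
  case (smult f c)
  then show ?case using U_ideal.smult by (simp add: fa_smult_def fa_mult_scale_right)
qed

lemma uequiv_refl [simp]: "uequiv f f"
  using U_ideal.zero by (simp add: uequiv_def fa_zero_def)

lemma uequiv_add: "uequiv f g \<Longrightarrow> uequiv f' g' \<Longrightarrow> uequiv (\<lambda>w. f w + f' w) (\<lambda>w. g w + g' w)"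
  using U_ideal.add[of "\<lambda>w. f w - g w" "\<lambda>w. f' w - g' w"]
  by (simp add: uequiv_def fa_add_def algebra_simps)

lemma uequiv_scale: "uequiv f g \<Longrightarrow> uequiv (\<lambda>w. c * f w) (\<lambda>w. c * g w)"
  using U_ideal.smult[of "\<lambda>w. f w - g w" c]
  by (simp add: uequiv_def fa_smult_def algebra_simps)

lemma uequiv_diff: "uequiv f g \<Longrightarrow> uequiv f' g' \<Longrightarrow> uequiv (\<lambda>w. f w - f' w) (\<lambda>w. g w - g' w)"
  using uequiv_add[of f g "\<lambda>w. -1 * f' w" "\<lambda>w. -1 * g' w"] uequiv_scale[of f' g' "-1"] by simp

lemma uequiv_trans [trans]: "uequiv f g \<Longrightarrow> uequiv g h \<Longrightarrow> uequiv f h"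
  using U_ideal.add[of "\<lambda>w. f w - g w" "\<lambda>w. g w - h w"] by (simp add: uequiv_def fa_add_def)

lemma uequiv_sum:
  "(\<And>i. i \<in> A \<Longrightarrow> uequiv (f i) (g i)) \<Longrightarrow> uequiv (\<lambda>w. \<Sum>i\<in>A. f i w) (\<lambda>w. \<Sum>i\<in>A. g i w)"
  using U_ideal_sum[of A "\<lambda>i w. f i w - g i w"] by (simp add: uequiv_def sum_subtractf)

lemma uequiv_mult_word:
  "uequiv f g \<Longrightarrow> set u \<subseteq> letters \<Longrightarrow> uequiv (fa_mult (fa_word u) f) (fa_mult (fa_word u) g)"
  using U_ideal_mult_word[of "\<lambda>w. f w - g w" u] by (simp add: uequiv_def fa_mult_diff_right)

lemma uequiv_word_swap:
  assumes "p \<in> letters" "q \<in> letters" "set u \<subseteq> letters" "set v \<subseteq> letters"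
  shows "uequiv (fa_word (u @ p # q # v))
    (\<lambda>w. fa_word (u @ q # p # v) w
       + (if fst p = fst q
          then \<Sum>c\<in>ix. sl2_struct (snd p) (snd q) c * fa_word (u @ (fst p, c) # v) w else 0))"
proof -
  have "fa_mult (fa_mult (fa_word u) (U_rel p q)) (fa_word v) =
      (\<lambda>w. fa_word (u @ p # q # v) w - (fa_word (u @ q # p # v) w
       + (if fst p = fst q
          then \<Sum>c\<in>ix. sl2_struct (snd p) (snd q) c * fa_word (u @ (fst p, c) # v) w else 0)))"
    by (cases "fst p = fst q")
      (simp_all add: U_rel_def fa_mult_diff_left fa_mult_diff_right fa_mult_word_word
        fa_mult_sum_left fa_mult_sum_right fa_mult_scale_left fa_mult_scale_right
        fa_mult_add_left fa_mult_add_right ix_def algebra_simps)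
  with U_ideal.gen[OF assms] show ?thesis by (simp add: uequiv_def)
qed

section \<open>Elements congruent to polynomials in the generators\<close>

definition gen_image :: "felem set" where
  "gen_image = {f. \<exists>g\<in>gen_alg. uequiv f g}"

lemma gen_image_uequiv: "uequiv f g \<Longrightarrow> g \<in> gen_image \<Longrightarrow> f \<in> gen_image"
  unfolding gen_image_def using uequiv_trans by blast

lemma gen_alg_gen_image: "f \<in> gen_alg \<Longrightarrow> f \<in> gen_image"
  unfolding gen_image_def using uequiv_refl by blast

lemma gen_image_add: "f \<in> gen_image \<Longrightarrow> g \<in> gen_image \<Longrightarrow> (\<lambda>w. f w + g w) \<in> gen_image"
  unfolding gen_image_def using uequiv_add gen_alg.add[unfolded fa_add_def] by blast

lemma gen_image_scale: "f \<in> gen_image \<Longrightarrow> (\<lambda>w. c * f w) \<in> gen_image"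
  unfolding gen_image_def using uequiv_scale gen_alg.smult[unfolded fa_smult_def] by blast

lemma gen_image_zero: "(\<lambda>w. 0) \<in> gen_image"
  using gen_image_scale[OF gen_alg_gen_image[OF gen_alg.one], of 0] by simp

text \<open>Each generator is a finite sum of words over \<open>letters\<close>. For an arbitrary
  left factor, say of infinite support, the product need not remain in
  \<open>U_ideal\<close>.\<close>

lemma uequiv_mult_generator:
  assumes "h \<in> {cas1, cas2, xel}" "uequiv f g"
  shows "uequiv (fa_mult h f) (fa_mult h g)"
proof -
  have *: "uequiv (fa_mult (\<lambda>w. \<Sum>i\<in>ix. fa_word [(j, i), (k, i)] w) f)
                 (fa_mult (\<lambda>w. \<Sum>i\<in>ix. fa_word [(j, i), (k, i)] w) g)"
    if "j \<in> {1,2}" "k \<in> {1,2}" for j k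
    unfolding fa_mult_sum_left
    by (intro uequiv_sum uequiv_mult_word assms) (use that in \<open>auto simp: letters_def ix_def\<close>)
  show ?thesis
    using assms(1) *[of 1 1] *[of 2 2] *[of 1 2] by (auto simp: ix_def cas1_def cas2_def xel_def)
qed

lemma gen_image_mult_generator:
  assumes "h \<in> {cas1, cas2, xel}" "f \<in> gen_image"
  shows "fa_mult h f \<in> gen_image"
proof -
  obtain g where g: "g \<in> gen_alg" "uequiv f g" using assms(2) by (auto simp: gen_image_def)
  have "h \<in> gen_alg" using assms(1) by (auto intro: gen_alg.intros)
  with g uequiv_mult_generator[OF assms(1) g(2)] show ?thesis
    unfolding gen_image_def by (auto intro: gen_alg.mult)
qed

section \<open>Invariant tensors\<close>

text \<open>Tensors are functions of an assignment of indices to labels. The members of the span below use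
  each label of the set exactly once.\<close>

inductive inv_tensor :: "nat set \<Rightarrow> ((nat \<Rightarrow> nat) \<Rightarrow> complex) \<Rightarrow> bool" where
  zero: "inv_tensor L (\<lambda>\<phi>. 0)"
| one: "inv_tensor {} (\<lambda>\<phi>. 1)"
| delta: "\<lbrakk>inv_tensor L T; a \<notin> L; b \<notin> L; a \<noteq> b\<rbrakk>
    \<Longrightarrow> inv_tensor (insert a (insert b L)) (\<lambda>\<phi>. delta (\<phi> a) (\<phi> b) * T \<phi>)"
| eps: "\<lbrakk>inv_tensor L T; a \<notin> L; b \<notin> L; c \<notin> L; a \<noteq> b; b \<noteq> c; a \<noteq> c\<rbrakk>
    \<Longrightarrow> inv_tensor (insert a (insert b (insert c L))) (\<lambda>\<phi>. eps (\<phi> a) (\<phi> b) (\<phi> c) * T \<phi>)"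
| add: "\<lbrakk>inv_tensor L T; inv_tensor L T'\<rbrakk> \<Longrightarrow> inv_tensor L (\<lambda>\<phi>. T \<phi> + T' \<phi>)"
| scale: "inv_tensor L T \<Longrightarrow> inv_tensor L (\<lambda>\<phi>. z * T \<phi>)"

lemma inv_tensor_diff: "inv_tensor L T \<Longrightarrow> inv_tensor L T' \<Longrightarrow> inv_tensor L (\<lambda>\<phi>. T \<phi> - T' \<phi>)"
  using inv_tensor.add[of L T "\<lambda>\<phi>. -1 * T' \<phi>"] inv_tensor.scale[of L T' "-1"] by simp

lemma inv_tensor_indep: "inv_tensor L T \<Longrightarrow> k \<notin> L \<Longrightarrow> T (\<phi>(k := i)) = T \<phi>"
  by (induction rule: inv_tensor.induct) auto

text \<open>In every term each label sits in a \<open>delta\<close> or an \<open>eps\<close>, and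
  both vanish outside \<open>ix\<close>. This supplies the hypothesis of \<open>sum_delta\<close>
  when a contraction replaces one label of T by another.\<close>

lemma inv_tensor_outside: "inv_tensor L T \<Longrightarrow> k \<in> L \<Longrightarrow> \<phi> k \<notin> ix \<Longrightarrow> T \<phi> = 0"
  by (induction rule: inv_tensor.induct) (auto simp: delta_def eps_def ix_def)

lemma inv_tensor_rename: "inv_tensor L T \<Longrightarrow> inj_on f L \<Longrightarrow> inv_tensor (f ` L) (\<lambda>\<phi>. T (\<phi> \<circ> f))"
proof (induction rule: inv_tensor.induct)
  case (delta L T a b)
  then show ?case
    using inv_tensor.delta[of "f ` L" "\<lambda>\<phi>. T (\<phi> \<circ> f)" "f a" "f b"]
      by (auto simp: inj_on_def comp_def)
next
  case (eps L T a b c)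
  then show ?case
    using inv_tensor.eps[of "f ` L" "\<lambda>\<phi>. T (\<phi> \<circ> f)" "f a" "f b" "f c"]
      by (auto simp: inj_on_def comp_def)
qed (auto intro: inv_tensor.intros)

text \<open>Summing T against a Kronecker symbol renames its label b to e. The case e = b is
  included, since the label freed by a contraction may be taken again.\<close>

lemma inv_tensor_substitute:
  assumes "inv_tensor L T" "b \<in> L" "e \<notin> L - {b}"
  shows "inv_tensor (insert e (L - {b})) (\<lambda>\<phi>. T (\<phi>(b := \<phi> e)))"
proof -
  have "inj_on (id(b := e)) L" using assms by (auto simp: inj_on_def)
  moreover have "id(b := e) ` L = insert e (L - {b})" using assms(2) by auto
  moreover have "\<phi> \<circ> id(b := e) = \<phi>(b := \<phi> e)" for \<phi> :: "nat \<Rightarrow> nat"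
    by auto
  ultimately show ?thesis using inv_tensor_rename[OF assms(1), of "id(b := e)"] by simp
qed

lemma sum_delta:
  assumes "x \<notin> ix \<Longrightarrow> f x = 0"
  shows "(\<Sum>k\<in>ix. delta k x * f k) = f x"
  using assms by (cases x rule: index_cases) (auto simp: delta_def ix_def)

lemma delta_sym: "delta a b = delta b a"
  by (auto simp: delta_def)

lemma eps_outside: "a \<notin> ix \<or> b \<notin> ix \<or> c \<notin> ix \<Longrightarrow> eps a b c = 0"
  by (auto simp: eps_def ix_def)

text \<open>A cyclic rotation brings any of the three labels to the front without a sign, so
  contractions have to be computed for one position only.\<close>

lemma eps_first:
  assumes "a \<in> {x, y, z}" "x \<noteq> y" "y \<noteq> z" "x \<noteq> z"
  obtains y' z' where "insert x (insert y (insert z L)) = insert a (insert y' (insert z' L))"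
    "{x, y, z} = {a, y', z'}" "a \<noteq> y'" "y' \<noteq> z'" "a \<noteq> z'"
    "\<And>\<phi>. eps (\<phi> x) (\<phi> y) (\<phi> z) = eps (\<phi> a) (\<phi> y') (\<phi> z')"
proof -
  consider "a = x" | "a = y" | "a = z" using assms(1) by blast
  then show thesis
  proof cases
    case 1
    show thesis by (rule that[of y z]) (use 1 assms in auto)
  next
    case 2
    show thesis by (rule that[of z x]) (use 2 assms eps_cyclic in auto)
  next
    case 3
    show thesis by (rule that[of x y]) (use 3 assms eps_cyclic in auto)
  qed
qed

text \<open>This is what remains of a commutator when a \<open>delta\<close> has absorbed one index
  of the structure constant: the \<open>eps\<close> is contracted with T in the single label b. The
  label c may equal b, which the contraction has freed.\<close>

lemma inv_tensor_attach:
  "\<lbrakk>inv_tensor L T; b \<in> L; e \<notin> L; c \<notin> L - {b}; e \<noteq> c\<rbrakk>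
    \<Longrightarrow> inv_tensor (insert e (insert c (L - {b}))) (\<lambda>\<phi>. \<Sum>k\<in>ix. eps (\<phi> e) k (\<phi> c) * T (\<phi>(b := k)))"
proof (induction arbitrary: rule: inv_tensor.induct)
  case (zero L)
  then show ?case by (simp add: inv_tensor.zero)
next
  case one
  then show ?case by simp
next
  case (delta L T x y)
  have *: ?case if "b = x'" "(x', y') \<in> {(x, y), (y, x)}" for x' y'
  proof -
    have "b \<notin> L" "y' \<notin> L" "b \<noteq> y'" "e \<noteq> y'" "c \<noteq> y'" "e \<notin> L" "c \<notin> L"
      and S: "insert x (insert y L) - {b} = insert y' L"
      using that delta by auto
    moreover have "(\<Sum>k\<in>ix. eps (\<phi> e) k (\<phi> c) *
        (delta ((\<phi>(b := k)) x) ((\<phi>(b := k)) y) * T (\<phi>(b := k))))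
      = eps (\<phi> e) (\<phi> y') (\<phi> c) * T \<phi>" for \<phi>
    proof -
      have "(\<Sum>k\<in>ix. eps (\<phi> e) k (\<phi> c) *
        (delta ((\<phi>(b := k)) x) ((\<phi>(b := k)) y) * T (\<phi>(b := k))))
        = (\<Sum>k\<in>ix. delta k (\<phi> y') * (eps (\<phi> e) k (\<phi> c) * T \<phi>))"
        using that delta inv_tensor_indep[OF delta(1)] by (intro sum.cong refl) (auto simp: delta_sym)
      then show ?thesis by (subst (asm) sum_delta) (auto simp: eps_outside)
    qed
    ultimately show ?thesis
      using inv_tensor.eps[OF delta(1), of e y' c] delta.prems
      by (simp add: S insert_commute del: fun_upd_apply)
  qed
  show ?case
  proof (cases "b = x \<or> b = y")
    case True
    then show ?thesis using * by blast
  next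
    case False
    then have b: "b \<in> L" using delta by auto
    have "inv_tensor (insert e (insert c (L - {b}))) (\<lambda>\<phi>. \<Sum>k\<in>ix. eps (\<phi> e) k (\<phi> c) * T (\<phi>(b := k)))"
      by (rule delta.IH) (use b delta in auto)
    from inv_tensor.delta[OF this, of x y]
    have "inv_tensor (insert x (insert y (insert e (insert c (L - {b})))))
      (\<lambda>\<phi>. \<Sum>k\<in>ix. eps (\<phi> e) k (\<phi> c) * (delta (\<phi> x) (\<phi> y) * T (\<phi>(b := k))))"
      using delta False by (auto simp: sum_distrib_left algebra_simps)
    moreover have "insert e (insert c (insert x (insert y L) - {b})) = insert x (insert y (insert e (insert c (L - {b}))))"
      using False by auto
    ultimately show ?thesis using False by (simp add: fun_upd_other del: fun_upd_apply)
  qed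
next
  case (eps L T x y z)
  show ?case
  proof (cases "b \<in> {x, y, z}")
    case True
    obtain y' z' where S: "insert x (insert y (insert z L)) = insert b (insert y' (insert z' L))"
      and yz: "{x, y, z} = {b, y', z'}" "b \<noteq> y'" "y' \<noteq> z'" "b \<noteq> z'"
      and E: "\<And>\<phi>. eps (\<phi> x) (\<phi> y) (\<phi> z) = eps (\<phi> b) (\<phi> y') (\<phi> z')"
      by (rule eps_first[OF True eps.hyps(5-7), of L]) (rule that; assumption)
    have "{b, y', z'} \<inter> L = {}"
      using eps.hyps unfolding yz(1)[symmetric] by auto
    then have L: "b \<notin> L" "y' \<notin> L" "z' \<notin> L" by auto
    have L2: "e \<notin> L" "e \<noteq> y'" "e \<noteq> z'" "c \<notin> L" "c \<noteq> y'" "c \<noteq> z'"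
      using eps.prems yz L unfolding S by auto
    have S': "insert e (insert c (insert x (insert y (insert z L)) - {b})) = insert c (insert y' (insert e (insert z' L)))"
      unfolding S using L yz by auto
    have S'': "insert e (insert c (insert x (insert y (insert z L)) - {b})) = insert c (insert z' (insert e (insert y' L)))"
      unfolding S using L yz by auto
    \<comment> \<open>Two Levi-Civita symbols share the index k, so the epsilon-delta identity
      leaves two pairs of Kronecker symbols.\<close>
    have "(\<Sum>k\<in>ix. eps (\<phi> e) k (\<phi> c) *
        (eps ((\<phi>(b := k)) x) ((\<phi>(b := k)) y) ((\<phi>(b := k)) z) * T (\<phi>(b := k))))
      = delta (\<phi> c) (\<phi> y') * (delta (\<phi> e) (\<phi> z') * T \<phi>) - delta (\<phi> c) (\<phi> z') * (delta (\<phi> e) (\<phi> y') * T \<phi>)" for \<phi>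
    proof -
      have "(\<Sum>k\<in>ix. eps (\<phi> e) k (\<phi> c) *
        (eps ((\<phi>(b := k)) x) ((\<phi>(b := k)) y) ((\<phi>(b := k)) z) * T (\<phi>(b := k))))
        = (\<Sum>k\<in>ix. eps k (\<phi> c) (\<phi> e) * eps k (\<phi> y') (\<phi> z')) * T \<phi>"
        unfolding E sum_distrib_right
        using yz inv_tensor_indep[OF eps(1) L(1)] eps_cyclic by (intro sum.cong refl) auto
      then show ?thesis unfolding eps_contract by (simp add: algebra_simps)
    qed
    moreover have "inv_tensor (insert c (insert y' (insert e (insert z' L)))) (\<lambda>\<phi>. delta (\<phi> c) (\<phi> y') * (delta (\<phi> e) (\<phi> z') * T \<phi>))"
      by (intro inv_tensor.delta eps) (use L L2 yz eps.prems in auto)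
    moreover have "inv_tensor (insert c (insert z' (insert e (insert y' L)))) (\<lambda>\<phi>. delta (\<phi> c) (\<phi> z') * (delta (\<phi> e) (\<phi> y') * T \<phi>))"
      by (intro inv_tensor.delta eps) (use L L2 yz eps.prems in auto)
    ultimately show ?thesis using S' S'' inv_tensor_diff by (simp del: fun_upd_apply)
  next
    case False
    then have b: "b \<in> L" using eps by auto
    have "inv_tensor (insert e (insert c (L - {b}))) (\<lambda>\<phi>. \<Sum>k\<in>ix. eps (\<phi> e) k (\<phi> c) * T (\<phi>(b := k)))"
      by (rule eps.IH) (use b eps in auto)
    from inv_tensor.eps[OF this, of x y z]
    have "inv_tensor (insert x (insert y (insert z (insert e (insert c (L - {b}))))))
      (\<lambda>\<phi>. \<Sum>k\<in>ix. eps (\<phi> e) k (\<phi> c) * (eps (\<phi> x) (\<phi> y) (\<phi> z) * T (\<phi>(b := k))))"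
      using eps False by (auto simp: sum_distrib_left algebra_simps)
    moreover have "insert e (insert c (insert x (insert y (insert z L)) - {b})) = insert x (insert y (insert z (insert e (insert c (L - {b})))))"
      using False by auto
    ultimately show ?thesis using False by (simp add: fun_upd_other del: fun_upd_apply)
  qed
next
  case (add L T T')
  then show ?case
    using inv_tensor.add[OF add.IH] by (simp add: sum.distrib[symmetric] algebra_simps)
next
  case (scale L T z)
  then show ?case
    using inv_tensor.scale[OF scale.IH, of z] by (simp add: sum_distrib_left algebra_simps)
qed

text \<open>The Kronecker symbol forces two indices of \<open>eps\<close> to agree, where
  \<open>eps\<close> vanishes. Hence the two ends of one \<open>delta\<close> leave no commutator
  term.\<close>

lemma eps_delta: "eps i k c * (delta i k * t) = 0" "eps i k c * (delta k i * t) = 0"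
proof -
  have "eps i i c = 0" by (auto simp: eps_def)
  then show "eps i k c * (delta i k * t) = 0" "eps i k c * (delta k i * t) = 0"
    by (cases "i = k"; simp add: delta_def)+
qed

text \<open>This is the tensor produced by a commutator of the letters labelled by a and b; the label a is
  reused for the letter that replaces them.\<close>

lemma inv_tensor_contract:
  "\<lbrakk>inv_tensor L T; a \<in> L; b \<in> L; a \<noteq> b\<rbrakk>
    \<Longrightarrow> inv_tensor (L - {b}) (\<lambda>\<phi>. \<Sum>i\<in>ix. \<Sum>k\<in>ix. eps i k (\<phi> a) * T (\<phi>(a := i, b := k)))"
proof (induction rule: inv_tensor.induct)
  case (zero L)
  then show ?case by (simp add: inv_tensor.zero)
next
  case one
  then show ?case by simp
next
  case (delta L T x y)
  \<comment> \<open>The new \<open>delta\<close> holds both of the commuted labels, only a, only b,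
    or neither.\<close>
  consider "{a, b} = {x, y}" | y' where "{a, y'} = {x, y}" "b \<in> L" | y' where "{b, y'} = {x, y}" "a \<in> L"
    | "a \<in> L" "b \<in> L"
  proof -
    have "a = x \<or> a = y \<or> a \<in> L" "b = x \<or> b = y \<or> b \<in> L" using delta.prems by auto
    then show thesis
      using that(1) that(2)[of x] that(2)[of y] that(3)[of x] that(3)[of y] that(4) delta.prems(3)
      by (elim disjE) (simp_all add: insert_commute)
  qed
  then show ?case
  proof cases
    case 1
    have "(\<Sum>i\<in>ix. \<Sum>k\<in>ix. eps i k (\<phi> a) *
        (delta ((\<phi>(a := i, b := k)) x) ((\<phi>(a := i, b := k)) y) * T (\<phi>(a := i, b := k)))) = 0" for \<phi>
    proof -
      consider "a = x" "b = y" | "a = y" "b = x" using 1 by (auto simp: doubleton_eq_iff)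
      then show ?thesis using \<open>a \<noteq> b\<close> by cases (simp_all add: eps_delta)
    qed
    then show ?thesis by (simp add: inv_tensor.zero del: fun_upd_apply)
  next
    case (2 y')
    have L: "a \<notin> L" "y' \<notin> L" "a \<noteq> y'" using 2 delta.hyps by (auto simp: doubleton_eq_iff)
    have "(\<Sum>i\<in>ix. \<Sum>k\<in>ix. eps i k (\<phi> a) *
        (delta ((\<phi>(a := i, b := k)) x) ((\<phi>(a := i, b := k)) y) * T (\<phi>(a := i, b := k))))
      = (\<Sum>k\<in>ix. eps (\<phi> y') k (\<phi> a) * T (\<phi>(b := k)))" for \<phi>
    proof -
      have "T (\<phi>(a := i, b := k)) = T (\<phi>(b := k))" for i k
        using inv_tensor_indep[OF delta.hyps(1) L(1), of "\<phi>(b := k)" i] \<open>a \<noteq> b\<close>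
          by (simp add: fun_upd_twist)
      then have "(\<Sum>i\<in>ix. \<Sum>k\<in>ix. eps i k (\<phi> a) *
        (delta ((\<phi>(a := i, b := k)) x) ((\<phi>(a := i, b := k)) y) * T (\<phi>(a := i, b := k))))
        = (\<Sum>k\<in>ix. \<Sum>i\<in>ix. delta i (\<phi> y') * (eps i k (\<phi> a) * T (\<phi>(b := k))))"
        using 2 delta.hyps L by (subst sum.swap, intro sum.cong refl) (auto simp: doubleton_eq_iff delta_sym)
      also have "\<dots> = (\<Sum>k\<in>ix. eps (\<phi> y') k (\<phi> a) * T (\<phi>(b := k)))"
        by (intro sum.cong refl sum_delta) (simp add: eps_outside)
      finally show ?thesis .
    qed
    moreover have "insert x (insert y L) - {b} = insert y' (insert a (L - {b}))"
      using 2 delta.hyps by (auto simp: doubleton_eq_iff)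
    ultimately show ?thesis
      using inv_tensor_attach[OF delta.hyps(1) 2(2), of y' a] L by (simp del: fun_upd_apply)
  next
    case (3 y')
    have L: "b \<notin> L" "y' \<notin> L" "b \<noteq> y'" "a \<noteq> y'"
      using 3 delta.hyps by (auto simp: doubleton_eq_iff)
    \<comment> \<open>Now the second index of \<open>eps\<close> is absorbed; bringing it to the
      first place, as \<open>inv_tensor_attach\<close> requires, costs the sign. The label a is both
      contracted and reused.\<close>
    have "(\<Sum>i\<in>ix. \<Sum>k\<in>ix. eps i k (\<phi> a) *
        (delta ((\<phi>(a := i, b := k)) x) ((\<phi>(a := i, b := k)) y) * T (\<phi>(a := i, b := k))))
      = -1 * (\<Sum>i\<in>ix. eps (\<phi> y') i (\<phi> a) * T (\<phi>(a := i)))" for \<phi>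
    proof -
      have "T (\<phi>(a := i, b := k)) = T (\<phi>(a := i))" for i k
        using inv_tensor_indep[OF delta.hyps(1) L(1)] by simp
      then have "(\<Sum>i\<in>ix. \<Sum>k\<in>ix. eps i k (\<phi> a) *
        (delta ((\<phi>(a := i, b := k)) x) ((\<phi>(a := i, b := k)) y) * T (\<phi>(a := i, b := k))))
        = (\<Sum>i\<in>ix. \<Sum>k\<in>ix. delta k (\<phi> y') * (eps i k (\<phi> a) * T (\<phi>(a := i))))"
        using 3 delta.hyps L by (intro sum.cong refl) (auto simp: doubleton_eq_iff delta_sym)
      also have "\<dots> = (\<Sum>i\<in>ix. eps i (\<phi> y') (\<phi> a) * T (\<phi>(a := i)))"
        by (intro sum.cong refl sum_delta) (simp add: eps_outside)
      also have "\<dots> = -1 * (\<Sum>i\<in>ix. eps (\<phi> y') i (\<phi> a) * T (\<phi>(a := i)))"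
        unfolding sum_distrib_left by (intro sum.cong refl) (subst eps_antisym, simp)
      finally show ?thesis .
    qed
    moreover have "insert x (insert y L) - {b} = insert y' (insert a (L - {a}))"
      using 3 delta.hyps by (auto simp: doubleton_eq_iff)
    moreover have "inv_tensor (insert y' (insert a (L - {a}))) (\<lambda>\<phi>. -1 * (\<Sum>i\<in>ix. eps (\<phi> y') i (\<phi> a) * T (\<phi>(a := i))))"
      by (intro inv_tensor.scale inv_tensor_attach) (use delta.hyps 3 L in auto)
    ultimately show ?thesis by (simp only:)
  next
    case 4
    have xy: "a \<noteq> x" "a \<noteq> y" "b \<noteq> x" "b \<noteq> y" using 4 delta.hyps by auto
    have "inv_tensor (L - {b}) (\<lambda>\<phi>. \<Sum>i\<in>ix. \<Sum>k\<in>ix. eps i k (\<phi> a) * T (\<phi>(a := i, b := k)))"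
      by (rule delta.IH) (use 4 delta in auto)
    from inv_tensor.delta[OF this, of x y]
    have "inv_tensor (insert x (insert y (L - {b}))) (\<lambda>\<phi>. \<Sum>i\<in>ix. \<Sum>k\<in>ix. eps i k (\<phi> a) *
        (delta ((\<phi>(a := i, b := k)) x) ((\<phi>(a := i, b := k)) y) * T (\<phi>(a := i, b := k))))"
      using delta.hyps xy by (simp add: sum_distrib_left algebra_simps fun_upd_other del: fun_upd_apply)
    moreover have "insert x (insert y L) - {b} = insert x (insert y (L - {b}))"
      using xy by auto
    ultimately show ?thesis by (simp only:)
  qed
next
  case (eps L T x y z)
  show ?case
  proof (cases "a \<in> {x, y, z} \<or> b \<in> {x, y, z}")
    case False
    then have xy: "a \<noteq> x" "a \<noteq> y" "a \<noteq> z" "b \<noteq> x" "b \<noteq> y" "b \<noteq> z"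
      by auto
    have "inv_tensor (L - {b}) (\<lambda>\<phi>. \<Sum>i\<in>ix. \<Sum>k\<in>ix. eps i k (\<phi> a) * T (\<phi>(a := i, b := k)))"
      by (rule eps.IH) (use xy eps in auto)
    from inv_tensor.eps[OF this, of x y z]
    have "inv_tensor (insert x (insert y (insert z (L - {b})))) (\<lambda>\<phi>. \<Sum>i\<in>ix. \<Sum>k\<in>ix. eps i k (\<phi> a) *
        (eps ((\<phi>(a := i, b := k)) x) ((\<phi>(a := i, b := k)) y) ((\<phi>(a := i, b := k)) z) * T (\<phi>(a := i, b := k))))"
      using eps.hyps xy by (simp add: sum_distrib_left algebra_simps fun_upd_other del: fun_upd_apply)
    moreover have "insert x (insert y (insert z L)) - {b} = insert x (insert y (insert z (L - {b})))"
      using xy by auto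
    ultimately show ?thesis by (simp only:)
  next
    case True
    show ?thesis
    proof (cases "a \<in> {x, y, z}")
      case a: True
      obtain y' z' where S: "insert x (insert y (insert z L)) = insert a (insert y' (insert z' L))"
        and yz: "{x, y, z} = {a, y', z'}" "a \<noteq> y'" "y' \<noteq> z'" "a \<noteq> z'"
        and E: "\<And>\<phi>. eps (\<phi> x) (\<phi> y) (\<phi> z) = eps (\<phi> a) (\<phi> y') (\<phi> z')"
        by (rule eps_first[OF a eps.hyps(5-7), of L]) (rule that; assumption)
      have "{a, y', z'} \<inter> L = {}"
        using eps.hyps unfolding yz(1)[symmetric] by auto
      then have L: "a \<notin> L" "y' \<notin> L" "z' \<notin> L" by auto
      let ?S = "\<lambda>\<phi>. \<Sum>i\<in>ix. \<Sum>k\<in>ix. eps i k (\<phi> a) *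
        (eps ((\<phi>(a := i, b := k)) x) ((\<phi>(a := i, b := k)) y) ((\<phi>(a := i, b := k)) z) * T (\<phi>(a := i, b := k)))"
      have T: "T (\<phi>(a := i, b := k)) = T (\<phi>(b := k))" for i k \<phi>
        using inv_tensor_indep[OF eps.hyps(1) L(1), of "\<phi>(b := k)" i] \<open>a \<noteq> b\<close>
          by (simp add: fun_upd_twist)
      \<comment> \<open>The sum over i joins the structure constant to the \<open>eps\<close>
        containing a. Whether b lies in the same symbol is still open, so y' and z' are read after
        the update at b.\<close>
      have S2: "?S \<phi> = (\<Sum>k\<in>ix. (delta k ((\<phi>(b := k)) y') * delta (\<phi> a) ((\<phi>(b := k)) z')
          - delta k ((\<phi>(b := k)) z') * delta (\<phi> a) ((\<phi>(b := k)) y')) * T (\<phi>(b := k)))" for \<phi>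
      proof -
        have "?S \<phi> = (\<Sum>k\<in>ix. (\<Sum>i\<in>ix. eps i k (\<phi> a) * eps i ((\<phi>(b := k)) y') ((\<phi>(b := k)) z')) * T (\<phi>(b := k)))"
          unfolding E T sum_distrib_right using yz \<open>a \<noteq> b\<close>
          by (subst sum.swap, intro sum.cong refl) (auto simp: mult.assoc)
        then show ?thesis unfolding eps_contract .
      qed
      consider "b \<in> L" | "b = y'" | "b = z'" using eps.prems unfolding S by auto
      then show ?thesis
      proof cases
        case 1
        then have b: "b \<noteq> y'" "b \<noteq> z'" using L by auto
        have S3: "?S \<phi> = delta (\<phi> a) (\<phi> z') * T (\<phi>(b := \<phi> y')) - delta (\<phi> a) (\<phi> y') * T (\<phi>(b := \<phi> z'))" for \<phi>
        proof -
          have v: "T (\<phi>(b := n)) = 0" if "n \<notin> ix" for n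
            using inv_tensor_outside[OF eps.hyps(1) 1, of "\<phi>(b := n)"] that by simp
          have "?S \<phi> = (\<Sum>k\<in>ix. delta k (\<phi> y') * (delta (\<phi> a) (\<phi> z') * T (\<phi>(b := k))))
             - (\<Sum>k\<in>ix. delta k (\<phi> z') * (delta (\<phi> a) (\<phi> y') * T (\<phi>(b := k))))"
            unfolding S2 sum_subtractf[symmetric] using b by (intro sum.cong refl) (simp add: algebra_simps)
          then show ?thesis
            using sum_delta[of "\<phi> y'" "\<lambda>k. delta (\<phi> a) (\<phi> z') * T (\<phi>(b := k))"]
              sum_delta[of "\<phi> z'" "\<lambda>k. delta (\<phi> a) (\<phi> y') * T (\<phi>(b := k))"] v
                by simp
        qed
        have "inv_tensor (insert a (insert z' (insert y' (L - {b})))) (\<lambda>\<phi>. delta (\<phi> a) (\<phi> z') * T (\<phi>(b := \<phi> y')))"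
          by (intro inv_tensor.delta inv_tensor_substitute eps.hyps 1) (use L b yz in auto)
        moreover have "inv_tensor (insert a (insert y' (insert z' (L - {b})))) (\<lambda>\<phi>. delta (\<phi> a) (\<phi> y') * T (\<phi>(b := \<phi> z')))"
          by (intro inv_tensor.delta inv_tensor_substitute eps.hyps 1) (use L b yz in auto)
        moreover have "insert x (insert y (insert z L)) - {b} = insert a (insert z' (insert y' (L - {b})))"
          "insert a (insert y' (insert z' (L - {b}))) = insert a (insert z' (insert y' (L - {b})))"
          unfolding S using b \<open>a \<noteq> b\<close> by auto
        ultimately show ?thesis unfolding S3 using inv_tensor_diff by simp
      next
        case 2
        \<comment> \<open>Both letters lie in one symbol: the trace of \<open>delta\<close> over
          \<open>ix\<close> contributes 3, and the crossed term takes 1 away.\<close>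
        have S3: "?S \<phi> = 2 * (delta (\<phi> a) (\<phi> z') * T \<phi>)" for \<phi>
        proof -
          have "T (\<phi>(b := k)) = T \<phi>" for k using inv_tensor_indep[OF eps.hyps(1)] L 2 by blast
          then show ?thesis unfolding S2 using 2 yz
            by (cases "\<phi> z'" rule: index_cases; cases "\<phi> a" rule: index_cases)
              (auto simp: delta_def ix_def algebra_simps)
        qed
        have "insert x (insert y (insert z L)) - {b} = insert a (insert z' L)"
          unfolding S using 2 yz L \<open>a \<noteq> b\<close> by auto
        then show ?thesis unfolding S3 using inv_tensor.scale[OF inv_tensor.delta[OF eps.hyps(1), of a z'], of 2] L yz
          by simp
      next
        case 3
        \<comment> \<open>The same double contraction with b in the other slot of the antisymmetric
          symbol.\<close>
        have S3: "?S \<phi> = -2 * (delta (\<phi> a) (\<phi> y') * T \<phi>)" for \<phi>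
        proof -
          have "T (\<phi>(b := k)) = T \<phi>" for k using inv_tensor_indep[OF eps.hyps(1)] L 3 by blast
          then show ?thesis unfolding S2 using 3 yz
            by (cases "\<phi> y'" rule: index_cases; cases "\<phi> a" rule: index_cases)
              (auto simp: delta_def ix_def algebra_simps)
        qed
        have "insert x (insert y (insert z L)) - {b} = insert a (insert y' L)"
          unfolding S using 3 yz L \<open>a \<noteq> b\<close> by auto
        then show ?thesis unfolding S3 using inv_tensor.scale[OF inv_tensor.delta[OF eps.hyps(1), of a y'], of "-2"] L yz
          by simp
      qed
    next
      case a: False
      with True have b: "b \<in> {x, y, z}" by blast
      obtain y' z' where S: "insert x (insert y (insert z L)) = insert b (insert y' (insert z' L))"
        and yz: "{x, y, z} = {b, y', z'}" "b \<noteq> y'" "y' \<noteq> z'" "b \<noteq> z'"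
        and E: "\<And>\<phi>. eps (\<phi> x) (\<phi> y) (\<phi> z) = eps (\<phi> b) (\<phi> y') (\<phi> z')"
        by (rule eps_first[OF b eps.hyps(5-7), of L]) (rule that; assumption)
      have "{b, y', z'} \<inter> L = {}"
        using eps.hyps unfolding yz(1)[symmetric] by auto
      then have L: "b \<notin> L" "y' \<notin> L" "z' \<notin> L" by auto
      have a': "a \<noteq> y'" "a \<noteq> z'" using a yz by auto
      have aL: "a \<in> L" using eps.prems a by auto
      let ?S = "\<lambda>\<phi>. \<Sum>i\<in>ix. \<Sum>k\<in>ix. eps i k (\<phi> a) *
        (eps ((\<phi>(a := i, b := k)) x) ((\<phi>(a := i, b := k)) y) ((\<phi>(a := i, b := k)) z) * T (\<phi>(a := i, b := k)))"
      have T: "T (\<phi>(a := i, b := k)) = T (\<phi>(a := i))" for i k \<phi>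
        using inv_tensor_indep[OF eps.hyps(1) L(1)] by simp
      have S3: "?S \<phi> = delta (\<phi> a) (\<phi> y') * T (\<phi>(a := \<phi> z')) - delta (\<phi> a) (\<phi> z') * T (\<phi>(a := \<phi> y'))" for \<phi>
      proof -
        have v: "T (\<phi>(a := n)) = 0" if "n \<notin> ix" for n
          using inv_tensor_outside[OF eps.hyps(1) aL, of "\<phi>(a := n)"] that by simp
        have "?S \<phi> = (\<Sum>i\<in>ix. (\<Sum>k\<in>ix. eps k (\<phi> a) i * eps k (\<phi> y') (\<phi> z')) * T (\<phi>(a := i)))"
          unfolding E T sum_distrib_right using yz a' \<open>a \<noteq> b\<close>
          by (intro sum.cong refl) (simp add: mult.assoc eps_cyclic[of _ _ "\<phi> a"])
        also have "\<dots> = (\<Sum>i\<in>ix. delta i (\<phi> z') * (delta (\<phi> a) (\<phi> y') * T (\<phi>(a := i))))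
             - (\<Sum>i\<in>ix. delta i (\<phi> y') * (delta (\<phi> a) (\<phi> z') * T (\<phi>(a := i))))"
          unfolding eps_contract sum_subtractf[symmetric] by (intro sum.cong refl) (simp add: algebra_simps)
        finally show ?thesis
          using sum_delta[of "\<phi> z'" "\<lambda>i. delta (\<phi> a) (\<phi> y') * T (\<phi>(a := i))"]
            sum_delta[of "\<phi> y'" "\<lambda>i. delta (\<phi> a) (\<phi> z') * T (\<phi>(a := i))"] v
              by simp
      qed
      have "inv_tensor (insert a (insert y' (insert z' (L - {a})))) (\<lambda>\<phi>. delta (\<phi> a) (\<phi> y') * T (\<phi>(a := \<phi> z')))"
        by (intro inv_tensor.delta inv_tensor_substitute eps.hyps aL) (use L a' yz in auto)
      moreover have "inv_tensor (insert a (insert z' (insert y' (L - {a})))) (\<lambda>\<phi>. delta (\<phi> a) (\<phi> z') * T (\<phi>(a := \<phi> y')))"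
        by (intro inv_tensor.delta inv_tensor_substitute eps.hyps aL) (use L a' yz in auto)
      moreover have "insert x (insert y (insert z L)) - {b} = insert a (insert y' (insert z' (L - {a})))"
          "insert a (insert z' (insert y' (L - {a}))) = insert a (insert y' (insert z' (L - {a})))"
        unfolding S using L yz a' aL by auto
      ultimately show ?thesis unfolding S3 using inv_tensor_diff by simp
    qed
  qed
next
  case (add L T T')
  then show ?case
    using inv_tensor.add[OF add.IH] by (simp add: sum.distrib[symmetric] algebra_simps)
next
  case (scale L T z)
  then show ?case
    using inv_tensor.scale[OF scale.IH, of z] by (simp add: sum_distrib_left algebra_simps)
qed

section \<open>Words contracted with tensors\<close>

text \<open>The second argument lists the strand and the label of each letter. For distinct labels this is the
  sum over all assignments of indices to the labels, weighted by the tensor; the first argument is the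
  part of the word already read, and the last one fixes indices of labels that do not occur.\<close>

primrec tensor_elem :: "letter list \<Rightarrow> letter list \<Rightarrow> ((nat \<Rightarrow> nat) \<Rightarrow> complex) \<Rightarrow> (nat \<Rightarrow> nat) \<Rightarrow> felem" where
  "tensor_elem u [] T \<phi> = (\<lambda>w. T \<phi> * fa_word u w)"
| "tensor_elem u (p # ls) T \<phi> = (\<lambda>w. \<Sum>i\<in>ix. tensor_elem (u @ [(fst p, i)]) ls T (\<phi>(snd p := i)) w)"

lemma tensor_elem_sum: "tensor_elem u ls (\<lambda>\<psi>. \<Sum>i\<in>A. T i \<psi>) \<phi> w = (\<Sum>i\<in>A. tensor_elem u ls (T i) \<phi> w)"
  by (induction ls arbitrary: u \<phi>) (simp_all add: sum_distrib_right sum.swap[of _ A])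

lemma tensor_elem_add: "tensor_elem u ls (\<lambda>\<psi>. T \<psi> + T' \<psi>) \<phi> w = tensor_elem u ls T \<phi> w + tensor_elem u ls T' \<phi> w"
  by (induction ls arbitrary: u \<phi>) (simp_all add: algebra_simps sum.distrib)

lemma tensor_elem_scale: "tensor_elem u ls (\<lambda>\<psi>. z * T \<psi>) \<phi> w = z * tensor_elem u ls T \<phi> w"
  by (induction ls arbitrary: u \<phi>) (simp_all add: sum_distrib_left)

lemma tensor_elem_zero: "tensor_elem u ls (\<lambda>\<psi>. 0) \<phi> w = 0"
  by (induction ls arbitrary: u \<phi>) simp_all

text \<open>A substitution h that commutes with the assignments still to come, for instance one that
  touches only other labels, can be carried out at the start.\<close>

lemma tensor_elem_comp:
  assumes "\<And>k \<psi> i. k \<in> snd ` set ls \<Longrightarrow> h (\<psi>(k := i)) = (h \<psi>)(k := i)"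
  shows "tensor_elem u ls (\<lambda>\<psi>. T (h \<psi>)) \<phi> = tensor_elem u ls T (h \<phi>)"
  using assms by (induction ls arbitrary: u \<phi>) simp_all

lemma tensor_elem_weight:
  assumes "\<And>k \<psi> i. k \<in> snd ` set ls \<Longrightarrow> g (\<psi>(k := i)) = g \<psi>"
  shows "tensor_elem u ls (\<lambda>\<psi>. g \<psi> * T \<psi>) \<phi> w = g \<phi> * tensor_elem u ls T \<phi> w"
  using assms by (induction ls arbitrary: u \<phi>) (simp_all add: sum_distrib_left)

lemma tensor_elem_prefix: "tensor_elem u ls T \<phi> = fa_mult (fa_word u) (tensor_elem [] ls T \<phi>)"
proof (induction ls arbitrary: u \<phi>)
  case Nil
  then show ?case by (simp add: fa_mult_scale_right fa_mult_word_word)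
next
  case (Cons p ls)
  have "tensor_elem (u @ [l]) ls T \<psi> = fa_mult (fa_word u) (tensor_elem [l] ls T \<psi>)" for l \<psi>
    using Cons.IH[of "u @ [l]" \<psi>] Cons.IH[of "[l]" \<psi>]
    by (simp add: fa_mult_word_word fa_mult_assoc[symmetric])
  then show ?case by (simp add: fa_mult_sum_right)
qed

text \<open>The two letters belong to the prefix already read, where their indices are fixed, so the
  congruence of words passes through the remaining sums.\<close>

lemma tensor_elem_word_swap:
  assumes "p \<in> letters" "q \<in> letters" "set u \<subseteq> letters" "set v \<subseteq> letters" "fst ` set ls \<subseteq> {1, 2}"
  shows "uequiv (tensor_elem (u @ p # q # v) ls T \<phi>)
    (\<lambda>w. tensor_elem (u @ q # p # v) ls T \<phi> w
       + (if fst p = fst q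
          then \<Sum>c\<in>ix. sl2_struct (snd p) (snd q) c * tensor_elem (u @ (fst p, c) # v) ls T \<phi> w else 0))"
  using assms(4,5)
proof (induction ls arbitrary: v \<phi>)
  case Nil
  then show ?case
    using uequiv_scale[OF uequiv_word_swap[OF assms(1-3) Nil(1)], of "T \<phi>"]
    by (cases "fst p = fst q") (simp_all add: algebra_simps sum_distrib_left)
next
  case (Cons l ls)
  have "uequiv (tensor_elem (u @ p # q # v) (l # ls) T \<phi>)
     (\<lambda>w. \<Sum>i\<in>ix. tensor_elem (u @ q # p # v @ [(fst l, i)]) ls T (\<phi>(snd l := i)) w
       + (if fst p = fst q
          then \<Sum>c\<in>ix. sl2_struct (snd p) (snd q) c * tensor_elem (u @ (fst p, c) # v @ [(fst l, i)]) ls T (\<phi>(snd l := i)) w else 0))"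
    unfolding tensor_elem.simps append.simps append_assoc
    by (intro uequiv_sum Cons.IH) (use Cons.prems in \<open>auto simp: letters_def ix_def\<close>)
  moreover have "(\<lambda>w. \<Sum>i\<in>ix. tensor_elem (u @ q # p # v @ [(fst l, i)]) ls T (\<phi>(snd l := i)) w
       + (if fst p = fst q
          then \<Sum>c\<in>ix. sl2_struct (snd p) (snd q) c * tensor_elem (u @ (fst p, c) # v @ [(fst l, i)]) ls T (\<phi>(snd l := i)) w else 0))
    = (\<lambda>w. tensor_elem (u @ q # p # v) (l # ls) T \<phi> w
       + (if fst p = fst q
          then \<Sum>c\<in>ix. sl2_struct (snd p) (snd q) c * tensor_elem (u @ (fst p, c) # v) (l # ls) T \<phi> w else 0))"
    by (rule ext, cases "fst p = fst q") (auto simp: sum.distrib sum_distrib_left intro: sum.swap)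
  ultimately show ?case by simp
qed

lemma letters_iff: "(j, i) \<in> letters \<longleftrightarrow> j \<in> {1, 2} \<and> i \<in> ix"
  by (auto simp: letters_def ix_def)

text \<open>Here the indices of the two letters are summed over, and the index c of the commutator
  becomes that of a new letter. Storing c under the label a turns the sum over the old indices into
  the contracted tensor.\<close>

lemma tensor_elem_swap_head:
  assumes u: "set u \<subseteq> letters" and j: "j \<in> {1, 2}" "j' \<in> {1, 2}" "fst ` set ls \<subseteq> {1, 2}"
    and ab: "a \<noteq> b" "a \<notin> snd ` set ls" "b \<notin> snd ` set ls"
  shows "uequiv (tensor_elem u ((j, a) # (j', b) # ls) T \<phi>)
    (\<lambda>w. tensor_elem u ((j', b) # (j, a) # ls) T \<phi> w
      + (if j = j' then tensor_elem u ((j, a) # ls)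
           (\<lambda>\<psi>. \<i> * (\<Sum>i\<in>ix. \<Sum>k\<in>ix. eps i k (\<psi> a) * T (\<psi>(a := i, b := k)))) \<phi> w else 0))"
proof -
  let ?\<phi> = "\<lambda>i k. \<phi>(a := i, b := k)"
  let ?R = "\<lambda>i k w. tensor_elem (u @ (j', k) # (j, i) # []) ls T (?\<phi> i k) w
        + (if fst (j, i) = fst (j', k) then \<Sum>c\<in>ix. sl2_struct (snd (j, i)) (snd (j', k)) c
             * tensor_elem (u @ (fst (j, i), c) # []) ls T (?\<phi> i k) w else 0)"
  have "uequiv (tensor_elem (u @ [(j, i), (j', k)]) ls T (?\<phi> i k)) (?R i k)" if "i \<in> ix" "k \<in> ix" for i k
    by (rule tensor_elem_word_swap) (use that assms in \<open>simp_all add: letters_iff\<close>)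
  then have "uequiv (tensor_elem u ((j, a) # (j', b) # ls) T \<phi>) (\<lambda>w. \<Sum>i\<in>ix. \<Sum>k\<in>ix. ?R i k w)"
    by (simp only: tensor_elem.simps append.simps append_assoc fst_conv snd_conv) (intro uequiv_sum)
  moreover have "(\<lambda>w. \<Sum>i\<in>ix. \<Sum>k\<in>ix. tensor_elem (u @ (j', k) # (j, i) # []) ls T (?\<phi> i k) w
        + (if fst (j, i) = fst (j', k) then \<Sum>c\<in>ix. sl2_struct (snd (j, i)) (snd (j', k)) c
             * tensor_elem (u @ (fst (j, i), c) # []) ls T (?\<phi> i k) w else 0))
    = (\<lambda>w. tensor_elem u ((j', b) # (j, a) # ls) T \<phi> w
      + (if j = j' then \<Sum>c\<in>ix. \<Sum>i\<in>ix. \<Sum>k\<in>ix. \<i> * eps i k c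
             * tensor_elem (u @ [(j, c)]) ls T (?\<phi> i k) w else 0))"
  proof
    fix w
    have "(\<Sum>i\<in>ix. \<Sum>k\<in>ix. tensor_elem (u @ [(j', k), (j, i)]) ls T (?\<phi> i k) w) = tensor_elem u ((j', b) # (j, a) # ls) T \<phi> w"
      using ab by (simp add: fun_upd_twist) (rule sum.swap)
    moreover have "(\<Sum>i\<in>ix. \<Sum>k\<in>ix. \<Sum>c\<in>ix. sl2_struct i k c * tensor_elem (u @ [(j, c)]) ls T (?\<phi> i k) w)
      = (\<Sum>c\<in>ix. \<Sum>i\<in>ix. \<Sum>k\<in>ix. \<i> * eps i k c * tensor_elem (u @ [(j, c)]) ls T (?\<phi> i k) w)"
      unfolding sl2_struct_eq by (subst sum.swap[of _ ix ix], subst sum.swap[of _ ix ix]) simp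
    ultimately show "(\<Sum>i\<in>ix. \<Sum>k\<in>ix. tensor_elem (u @ (j', k) # (j, i) # []) ls T (?\<phi> i k) w
        + (if fst (j, i) = fst (j', k) then \<Sum>c\<in>ix. sl2_struct (snd (j, i)) (snd (j', k)) c
             * tensor_elem (u @ (fst (j, i), c) # []) ls T (?\<phi> i k) w else 0))
      = tensor_elem u ((j', b) # (j, a) # ls) T \<phi> w
      + (if j = j' then \<Sum>c\<in>ix. \<Sum>i\<in>ix. \<Sum>k\<in>ix. \<i> * eps i k c
             * tensor_elem (u @ [(j, c)]) ls T (?\<phi> i k) w else 0)"
      by (cases "j = j'") (simp_all add: sum.distrib del: tensor_elem.simps)
  qed
  moreover have "tensor_elem (u @ [(j, c)]) ls
       (\<lambda>\<psi>. \<i> * (\<Sum>i\<in>ix. \<Sum>k\<in>ix. eps i k (\<psi> a) * T (\<psi>(a := i, b := k)))) (\<phi>(a := c)) w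
     = (\<Sum>i\<in>ix. \<Sum>k\<in>ix. \<i> * eps i k c * tensor_elem (u @ [(j, c)]) ls T (?\<phi> i k) w)" for c w
  proof -
    have "tensor_elem (u @ [(j, c)]) ls (\<lambda>\<psi>. T (\<psi>(a := i, b := k))) (\<phi>(a := c))
        = tensor_elem (u @ [(j, c)]) ls T (\<phi>(a := i, b := k))" for i k
      by (subst tensor_elem_comp[where h="\<lambda>\<psi>. \<psi>(a := i, b := k)"]) (use ab in \<open>auto simp: fun_eq_iff\<close>)
    moreover have "tensor_elem (u @ [(j, c)]) ls (\<lambda>\<psi>. eps i k (\<psi> a) * T' \<psi>) (\<phi>(a := c)) w
        = eps i k c * tensor_elem (u @ [(j, c)]) ls T' (\<phi>(a := c)) w" for i k T'
      by (subst tensor_elem_weight[where g="\<lambda>\<psi>. eps i k (\<psi> a)"]) (use ab in auto)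
    ultimately show ?thesis
      by (simp add: tensor_elem_scale tensor_elem_sum sum_distrib_left mult.assoc)
  qed
  ultimately show ?thesis by (cases "j = j'") simp_all
qed

text \<open>Reading the letters of \<open>us\<close> into the prefix one by one brings the pair to
  the head.\<close>

lemma tensor_elem_swap:
  assumes u: "set u \<subseteq> letters" "fst ` set us \<subseteq> {1, 2}" and j: "j \<in> {1, 2}" "j' \<in> {1, 2}" "fst ` set ls \<subseteq> {1, 2}"
    and ab: "a \<noteq> b" "a \<notin> snd ` set ls" "b \<notin> snd ` set ls"
  shows "uequiv (tensor_elem u (us @ (j, a) # (j', b) # ls) T \<phi>)
    (\<lambda>w. tensor_elem u (us @ (j', b) # (j, a) # ls) T \<phi> w
      + (if j = j' then tensor_elem u (us @ (j, a) # ls)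
           (\<lambda>\<psi>. \<i> * (\<Sum>i\<in>ix. \<Sum>k\<in>ix. eps i k (\<psi> a) * T (\<psi>(a := i, b := k)))) \<phi> w else 0))"
  using u
proof (induction us arbitrary: u \<phi>)
  case Nil
  then show ?case using tensor_elem_swap_head[OF Nil(1) j ab, of T \<phi>] by (simp only: append.simps)
next
  case (Cons l us)
  let ?T = "\<lambda>\<psi>. \<i> * (\<Sum>i\<in>ix. \<Sum>k\<in>ix. eps i k (\<psi> a) * T (\<psi>(a := i, b := k)))"
  let ?R = "\<lambda>u us \<phi> w. tensor_elem u (us @ (j', b) # (j, a) # ls) T \<phi> w
      + (if j = j' then tensor_elem u (us @ (j, a) # ls) ?T \<phi> w else 0)"
  have "uequiv (\<lambda>w. \<Sum>i\<in>ix. tensor_elem (u @ [(fst l, i)]) (us @ (j, a) # (j', b) # ls) T (\<phi>(snd l := i)) w)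
    (\<lambda>w. \<Sum>i\<in>ix. ?R (u @ [(fst l, i)]) us (\<phi>(snd l := i)) w)"
    by (intro uequiv_sum Cons.IH) (use Cons.prems in \<open>auto simp: letters_iff\<close>)
  moreover have "(\<lambda>w. \<Sum>i\<in>ix. ?R (u @ [(fst l, i)]) us (\<phi>(snd l := i)) w) = ?R u (l # us) \<phi>"
    by (rule ext, cases "j = j'") (simp_all add: sum.distrib)
  ultimately show ?case by simp
qed

section \<open>Reordering letters modulo shorter words\<close>

definition lower_in_image :: "nat \<Rightarrow> (nat \<Rightarrow> nat) \<Rightarrow> bool" where
  "lower_in_image n \<phi> \<longleftrightarrow> (\<forall>ls T. length ls < n \<longrightarrow> distinct (map snd ls) \<longrightarrow> fst ` set ls \<subseteq> {1, 2}
     \<longrightarrow> inv_tensor (snd ` set ls) T \<longrightarrow> tensor_elem [] ls T \<phi> \<in> gen_image)"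

lemma lower_in_imageD:
  "\<lbrakk>lower_in_image n \<phi>; length ls < n; distinct (map snd ls); fst ` set ls \<subseteq> {1, 2}; inv_tensor (snd ` set ls) T\<rbrakk>
    \<Longrightarrow> tensor_elem [] ls T \<phi> \<in> gen_image"
  by (simp add: lower_in_image_def)

lemma lower_in_image_mono: "lower_in_image n \<phi> \<Longrightarrow> m \<le> n \<Longrightarrow> lower_in_image m \<phi>"
  by (simp add: lower_in_image_def)

text \<open>The commutator term has lost the label b and with it one letter, so the hypothesis on
  shorter words covers it; for letters on different strands the term is absent.\<close>

lemma tensor_elem_swap_gen_image:
  assumes low: "lower_in_image (length (us @ p # q # ls)) \<phi>"
    and d: "distinct (map snd (us @ p # q # ls))" and j: "fst ` set (us @ p # q # ls) \<subseteq> {1, 2}"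
    and T: "inv_tensor (snd ` set (us @ p # q # ls)) T"
  shows "(\<lambda>w. tensor_elem [] (us @ p # q # ls) T \<phi> w - tensor_elem [] (us @ q # p # ls) T \<phi> w) \<in> gen_image"
proof -
  obtain i a k b where pq: "p = (i, a)" "q = (k, b)" by fastforce
  let ?T = "\<lambda>\<psi>. \<i> * (\<Sum>i\<in>ix. \<Sum>k\<in>ix. eps i k (\<psi> a) * T (\<psi>(a := i, b := k)))"
  have "inv_tensor (snd ` set (us @ p # q # ls) - {b}) ?T"
    by (intro inv_tensor.scale inv_tensor_contract T) (use d pq in auto)
  moreover have "snd ` set (us @ p # q # ls) - {b} = snd ` set (us @ p # ls)"
    using d pq by (auto simp: image_iff)
  ultimately have "inv_tensor (snd ` set (us @ p # ls)) ?T" by simp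
  then have 1: "tensor_elem [] (us @ p # ls) ?T \<phi> \<in> gen_image"
    by (rule lower_in_imageD[OF low, rotated 3]) (use d j in auto)
  have "uequiv (tensor_elem [] (us @ p # q # ls) T \<phi>)
    (\<lambda>w. tensor_elem [] (us @ q # p # ls) T \<phi> w + (if i = k then tensor_elem [] (us @ p # ls) ?T \<phi> w else 0))"
    unfolding pq by (rule tensor_elem_swap) (use d j pq in auto)
  from uequiv_diff[OF this uequiv_refl[of "tensor_elem [] (us @ q # p # ls) T \<phi>"]]
  have "uequiv (\<lambda>w. tensor_elem [] (us @ p # q # ls) T \<phi> w - tensor_elem [] (us @ q # p # ls) T \<phi> w)
    (\<lambda>w. if i = k then tensor_elem [] (us @ p # ls) ?T \<phi> w else 0)" by simp
  then show ?thesis using 1 gen_image_zero by (cases "i = k") (auto intro: gen_image_uequiv)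
qed

lemma gen_image_diff_trans:
  "(\<lambda>w. f w - g w) \<in> gen_image \<Longrightarrow> (\<lambda>w. g w - h w) \<in> gen_image \<Longrightarrow> (\<lambda>w. f w - h w) \<in> gen_image"
  using gen_image_add[of "\<lambda>w. f w - g w" "\<lambda>w. g w - h w"] by simp

lemma gen_image_diff_cancel:
  "(\<lambda>w. f w - g w) \<in> gen_image \<Longrightarrow> g \<in> gen_image \<Longrightarrow> f \<in> gen_image"
  using gen_image_add[of "\<lambda>w. f w - g w" g] by simp

lemma tensor_elem_move_gen_image:
  assumes "lower_in_image (length (us @ xs @ p # ls)) \<phi>"
    and "distinct (map snd (us @ xs @ p # ls))" and "fst ` set (us @ xs @ p # ls) \<subseteq> {1, 2}"
    and "inv_tensor (snd ` set (us @ xs @ p # ls)) T"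
  shows "(\<lambda>w. tensor_elem [] (us @ xs @ p # ls) T \<phi> w - tensor_elem [] (us @ p # xs @ ls) T \<phi> w) \<in> gen_image"
  using assms
proof (induction xs arbitrary: ls rule: rev_induct)
  case Nil
  then show ?case using gen_image_zero by simp
next
  case (snoc x xs)
  have "(\<lambda>w. tensor_elem [] ((us @ xs) @ x # p # ls) T \<phi> w - tensor_elem [] ((us @ xs) @ p # x # ls) T \<phi> w) \<in> gen_image"
    by (rule tensor_elem_swap_gen_image) (use snoc.prems in simp_all)
  moreover have "snd ` set (us @ xs @ p # x # ls) = snd ` set (us @ (xs @ [x]) @ p # ls)" by auto
  then have "(\<lambda>w. tensor_elem [] (us @ xs @ p # x # ls) T \<phi> w - tensor_elem [] (us @ p # xs @ x # ls) T \<phi> w) \<in> gen_image"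
    by (intro snoc.IH) (use snoc.prems in auto)
  ultimately show ?case using gen_image_diff_trans by simp
qed

lemma tensor_elem_front_gen_image:
  assumes low: "lower_in_image (length ls) \<phi>"
    and d: "distinct (map snd ls)" and j: "fst ` set ls \<subseteq> {1, 2}" and T: "inv_tensor (snd ` set ls) T"
    and pq: "p \<in> set ls" "q \<in> set ls" "p \<noteq> q"
  obtains rest where "length ls = length (p # q # rest)" "set ls = set (p # q # rest)"
    "distinct (map snd (p # q # rest))"
    "(\<lambda>w. tensor_elem [] ls T \<phi> w - tensor_elem [] (p # q # rest) T \<phi> w) \<in> gen_image"
proof -
  obtain us vs where 1: "ls = us @ p # vs" using split_list pq(1) by metis
  with pq have "q \<in> set (us @ vs)" by auto
  then obtain xs ys where 2: "us @ vs = xs @ q # ys" using split_list by metis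
  have s: "set (us @ vs) = set (xs @ q # ys)" "length (us @ vs) = length (xs @ q # ys)" using 2 by simp_all
  have "distinct (map snd (p # us @ vs))" using d 1 by auto
  then have d': "distinct (map snd (p # xs @ q # ys))" using 2 by simp
  have set: "set ls = set (p # xs @ q # ys)" using 1 s by auto
  have len: "length ls = length (p # xs @ q # ys)" using 1 s by simp
  have "(\<lambda>w. tensor_elem [] ([] @ us @ p # vs) T \<phi> w - tensor_elem [] ([] @ p # us @ vs) T \<phi> w) \<in> gen_image"
    by (rule tensor_elem_move_gen_image) (use low d j T 1 in simp_all)
  moreover have "(\<lambda>w. tensor_elem [] ([p] @ xs @ q # ys) T \<phi> w - tensor_elem [] ([p] @ q # xs @ ys) T \<phi> w) \<in> gen_image"
    by (rule tensor_elem_move_gen_image) (use low d' j T set len in \<open>simp_all del: tensor_elem.simps\<close>)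
  ultimately have "(\<lambda>w. tensor_elem [] ls T \<phi> w - tensor_elem [] (p # q # xs @ ys) T \<phi> w) \<in> gen_image"
    using 1 2 gen_image_diff_trans by (simp del: tensor_elem.simps)
  then show thesis using d' set len by (intro that[of "xs @ ys"]) auto
qed

text \<open>With both ends of the \<open>delta\<close> in front, nothing separates them: the double
  sum collapses to a quadratic factor, and T, which ignores a and b, stays with the rest.\<close>

lemma tensor_elem_delta_head:
  assumes ab: "a \<noteq> b" "a \<notin> snd ` set ls" "b \<notin> snd ` set ls"
    and T: "\<And>\<psi> i k. T (\<psi>(a := i, b := k)) = T \<psi>"
  shows "tensor_elem [] ((j, a) # (k, b) # ls) (\<lambda>\<psi>. delta (\<psi> a) (\<psi> b) * T \<psi>) \<phi>
    = fa_mult (\<lambda>w. \<Sum>i\<in>ix. fa_word [(j, i), (k, i)] w) (tensor_elem [] ls T \<phi>)"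
proof
  fix w
  have 1: "tensor_elem u ls (\<lambda>\<psi>. delta (\<psi> a) (\<psi> b) * T \<psi>) (\<phi>(a := i, b := l)) w = delta i l * tensor_elem u ls T \<phi> w" for u i l
  proof -
    have "tensor_elem u ls T \<phi> = tensor_elem u ls (\<lambda>\<psi>. T (\<psi>(a := i, b := l))) \<phi>"
      using T by simp
    also have "\<dots> = tensor_elem u ls T (\<phi>(a := i, b := l))"
      by (subst tensor_elem_comp[where h="\<lambda>\<psi>. \<psi>(a := i, b := l)"]) (use ab in \<open>auto simp: fun_eq_iff\<close>)
    finally have "tensor_elem u ls T \<phi> = tensor_elem u ls T (\<phi>(a := i, b := l))" .
    then show ?thesis by (subst tensor_elem_weight[where g="\<lambda>\<psi>. delta (\<psi> a) (\<psi> b)"]) (use ab in auto)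
  qed
  have "(\<Sum>l\<in>ix. delta i l * f l) = f i" if "i \<in> ix" for i and f :: "nat \<Rightarrow> complex"
    using sum_delta[of i f] that by (simp add: delta_sym)
  then have "tensor_elem [] ((j, a) # (k, b) # ls) (\<lambda>\<psi>. delta (\<psi> a) (\<psi> b) * T \<psi>) \<phi> w
    = (\<Sum>i\<in>ix. tensor_elem [(j, i), (k, i)] ls T \<phi> w)"
    by (simp add: 1)
  then show "tensor_elem [] ((j, a) # (k, b) # ls) (\<lambda>\<psi>. delta (\<psi> a) (\<psi> b) * T \<psi>) \<phi> w
    = fa_mult (\<lambda>w. \<Sum>i\<in>ix. fa_word [(j, i), (k, i)] w) (tensor_elem [] ls T \<phi>) w"
    by (simp add: fa_mult_sum_left tensor_elem_prefix[of "[_, _]"])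
qed

text \<open>Exchanging the two letters changes the sign, but by the commutation relations it changes the
  element only by lower terms.\<close>

lemma tensor_elem_antisym_gen_image:
  assumes low: "lower_in_image (length ls) \<phi>"
    and d: "distinct (map snd ls)" and j: "fst ` set ls \<subseteq> {1, 2}" and T: "inv_tensor (snd ` set ls) T"
    and pq: "(j, a) \<in> set ls" "(j, b) \<in> set ls" "a \<noteq> b"
    and anti: "\<And>\<psi>. T (\<psi>(a := \<psi> b, b := \<psi> a)) = - T \<psi>"
  shows "tensor_elem [] ls T \<phi> \<in> gen_image"
proof -
  obtain rest where r: "length ls = length ((j, a) # (j, b) # rest)" "set ls = set ((j, a) # (j, b) # rest)"
    "distinct (map snd ((j, a) # (j, b) # rest))"
    and 1: "(\<lambda>w. tensor_elem [] ls T \<phi> w - tensor_elem [] ((j, a) # (j, b) # rest) T \<phi> w) \<in> gen_image"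
    by (rule tensor_elem_front_gen_image[OF low d j T pq(1,2)]) (use pq(3) in auto)
  let ?f = "tensor_elem [] ((j, a) # (j, b) # rest) T \<phi>" and ?g = "tensor_elem [] ((j, b) # (j, a) # rest) T \<phi>"
  have 2: "(\<lambda>w. tensor_elem [] ([] @ (j, a) # (j, b) # rest) T \<phi> w - tensor_elem [] ([] @ (j, b) # (j, a) # rest) T \<phi> w) \<in> gen_image"
    by (rule tensor_elem_swap_gen_image) (use r low j T in \<open>simp_all del: tensor_elem.simps\<close>)
  have "tensor_elem u rest T (\<phi>(b := i, a := k)) w = - tensor_elem u rest T (\<phi>(a := i, b := k)) w" for u i k w
  proof -
    have "tensor_elem u rest (\<lambda>\<psi>. T (\<psi>(a := \<psi> b, b := \<psi> a))) (\<phi>(a := i, b := k))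
        = tensor_elem u rest T ((\<phi>(a := i, b := k))(a := (\<phi>(a := i, b := k)) b, b := (\<phi>(a := i, b := k)) a))"
      by (rule tensor_elem_comp[where h="\<lambda>\<psi>. \<psi>(a := \<psi> b, b := \<psi> a)"]) (use r in \<open>auto simp: fun_eq_iff\<close>)
    moreover have "(\<phi>(a := i, b := k))(a := (\<phi>(a := i, b := k)) b, b := (\<phi>(a := i, b := k)) a) = \<phi>(b := i, a := k)"
      using pq(3) by (auto simp: fun_eq_iff)
    ultimately have "tensor_elem u rest T (\<phi>(b := i, a := k))
        = tensor_elem u rest (\<lambda>\<psi>. T (\<psi>(a := \<psi> b, b := \<psi> a))) (\<phi>(a := i, b := k))"
          by simp
    then show ?thesis unfolding anti using tensor_elem_scale[of u rest "-1" T] by simp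
  qed
  then have "?g w = - ?f w" for w
    by (simp add: sum_negf)
  then have "(\<lambda>w. (1/2) * (?f w - ?g w)) = ?f" by (simp del: tensor_elem.simps)
  then have "?f \<in> gen_image" using gen_image_scale[OF 2, of "1/2"] by (simp del: tensor_elem.simps)
  then show ?thesis using 1 gen_image_diff_cancel by blast
qed

text \<open>Two nested inductions. The outer one, on the length, permits reordering and handles the
  rest of the word once a \<open>delta\<close> is split off; the inner one, \<open>step\<close>,
  follows the construction of the tensor with the word left arbitrary.\<close>

lemma tensor_elem_gen_image:
  assumes "distinct (map snd ls)" "fst ` set ls \<subseteq> {1, 2}" "inv_tensor (snd ` set ls) T"
  shows "tensor_elem [] ls T \<phi> \<in> gen_image"
proof -
  have step: "tensor_elem [] ls T \<phi> \<in> gen_image"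
    if "inv_tensor L T" "lower_in_image (length ls) \<phi>" "distinct (map snd ls)" "fst ` set ls \<subseteq> {1, 2}" "snd ` set ls = L"
    for ls T L
    using that
  proof (induction rule: inv_tensor.induct)
    case (zero L)
    then show ?case using gen_image_zero by (simp add: tensor_elem_zero[abs_def])
  next
    case one
    then show ?case using gen_alg_gen_image[OF gen_alg.one] by simp
  next
    case (delta L T a b)
    \<comment> \<open>In \<open>xel\<close> the letter on strand 1 comes first, so a pair joining
      the strands must be read in the order (1, 2). The symmetry of \<open>delta\<close> allows
      this.\<close>
    have "\<exists>a' b' j k. (j, a') \<in> set ls \<and> (k, b') \<in> set ls \<and> {a', b'} = {a, b} \<and> (j, k) \<in> {(1, 1), (1, 2), (2, 2)}"
    proof -
      have "a \<in> snd ` set ls" "b \<in> snd ` set ls" using delta.prems(4) by auto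
      then obtain j k where jk: "(j, a) \<in> set ls" "(k, b) \<in> set ls" by auto
      then have "j \<in> {1, 2}" "k \<in> {1, 2}" using delta.prems(3) by force+
      then consider "(j, k) \<in> {(1, 1), (1, 2), (2, 2)}" | "(k, j) \<in> {(1, 1), (1, 2), (2, 2)}" by auto
      then show ?thesis
      proof cases
        case 1
        then show ?thesis using jk by blast
      next
        case 2
        moreover have "{b, a} = {a, b}" by auto
        ultimately show ?thesis using jk by blast
      qed
    qed
    then obtain a' b' j k where jk: "(j, a') \<in> set ls" "(k, b') \<in> set ls" "{a', b'} = {a, b}"
      "(j, k) \<in> {(1, 1), (1, 2), (2, 2)}" by blast
    then have ab: "a' \<noteq> b'" "a' \<notin> L" "b' \<notin> L"
      using delta.hyps by (auto simp: doubleton_eq_iff)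
    have T: "(\<lambda>\<psi>. delta (\<psi> a) (\<psi> b) * T \<psi>) = (\<lambda>\<psi>. delta (\<psi> a') (\<psi> b') * T \<psi>)"
      using jk(3) by (auto simp: doubleton_eq_iff delta_sym)
    have inv: "inv_tensor (snd ` set ls) (\<lambda>\<psi>. delta (\<psi> a) (\<psi> b) * T \<psi>)"
      unfolding delta.prems(4) by (intro inv_tensor.delta delta.hyps)
    obtain rest where r: "length ls = length ((j, a') # (k, b') # rest)" "set ls = set ((j, a') # (k, b') # rest)"
      "distinct (map snd ((j, a') # (k, b') # rest))"
      and 1: "(\<lambda>w. tensor_elem [] ls (\<lambda>\<psi>. delta (\<psi> a) (\<psi> b) * T \<psi>) \<phi> w
         - tensor_elem [] ((j, a') # (k, b') # rest) (\<lambda>\<psi>. delta (\<psi> a) (\<psi> b) * T \<psi>) \<phi> w) \<in> gen_image"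
      by (rule tensor_elem_front_gen_image[OF delta.prems(1-3) inv jk(1,2)]) (use ab in auto)
    have "insert a' (insert b' (snd ` set rest)) = insert a' (insert b' L)"
    proof -
      have "insert a' (insert b' L) = {a', b'} \<union> L" by simp
      also have "\<dots> = insert a (insert b L)" unfolding jk(3) by simp
      also have "\<dots> = snd ` set ls" using delta.prems(4) by simp
      also have "\<dots> = insert a' (insert b' (snd ` set rest))" unfolding r(2) by simp
      finally show ?thesis by simp
    qed
    then have L: "snd ` set rest = L" using ab r(3) by (simp add: insert_ident)
    have "tensor_elem [] rest T \<phi> \<in> gen_image"
      by (rule lower_in_imageD[OF delta.prems(1)]) (use delta.prems(3) delta.hyps(1) r L in auto)
    moreover have "(\<lambda>w. \<Sum>i\<in>ix. fa_word [(j, i), (k, i)] w) \<in> {cas1, cas2, xel}"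
      using jk(4) by (auto simp: cas1_def cas2_def xel_def ix_def)
    ultimately have "tensor_elem [] ((j, a') # (k, b') # rest) (\<lambda>\<psi>. delta (\<psi> a) (\<psi> b) * T \<psi>) \<phi> \<in> gen_image"
      unfolding T using ab L inv_tensor_indep[OF delta.hyps(1)]
      by (subst tensor_elem_delta_head) (auto intro: gen_image_mult_generator)
    then show ?case using 1 gen_image_diff_cancel by blast
  next
    case (eps L T a b c)
    have "a \<in> snd ` set ls" "b \<in> snd ` set ls" "c \<in> snd ` set ls" using eps.prems(4) by auto
    then obtain i j k where ijk: "(i, a) \<in> set ls" "(j, b) \<in> set ls" "(k, c) \<in> set ls" by auto
    then have "i \<in> {1, 2}" "j \<in> {1, 2}" "k \<in> {1, 2}" using eps.prems(3) by force+
    then consider "i = j" | "j = k" | "i = k" by auto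
    then obtain l x y where xy: "(l, x) \<in> set ls" "(l, y) \<in> set ls" "(x, y) \<in> {(a, b), (b, c), (a, c)}"
      using ijk by cases blast+
    have inv: "inv_tensor (snd ` set ls) (\<lambda>\<psi>. eps (\<psi> a) (\<psi> b) (\<psi> c) * T \<psi>)"
      unfolding eps.prems(4) by (intro inv_tensor.eps eps.hyps)
    have neq: "x \<noteq> y" using xy(3) eps.hyps by auto
    have T: "T (\<psi>(x := m, y := n)) = T \<psi>" for \<psi> m n
      using xy(3) eps.hyps inv_tensor_indep[OF eps.hyps(1)] by auto
    show ?case
    proof (rule tensor_elem_antisym_gen_image[OF eps.prems(1-3) inv xy(1,2) neq])
      fix \<psi> :: "nat \<Rightarrow> nat"
      have "eps p q r = - eps q p r" "eps p q r = - eps p r q" "eps p q r = - eps r q p" for p q r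
        by (metis eps_antisym eps_cyclic)+
      note anti = this[of "\<psi> a" "\<psi> b" "\<psi> c"]
      consider "x = a" "y = b" | "x = b" "y = c" | "x = a" "y = c" using xy(3) by auto
      then show "eps ((\<psi>(x := \<psi> y, y := \<psi> x)) a) ((\<psi>(x := \<psi> y, y := \<psi> x)) b) ((\<psi>(x := \<psi> y, y := \<psi> x)) c)
          * T (\<psi>(x := \<psi> y, y := \<psi> x)) = - (eps (\<psi> a) (\<psi> b) (\<psi> c) * T \<psi>)"
      proof cases
        case 1
        then show ?thesis using eps.hyps anti(1) T by simp
      next
        case 2
        then show ?thesis using eps.hyps anti(2) T by simp
      next
        case 3
        then show ?thesis using eps.hyps anti(3) T by simp
      qed
    qed
  next
    case (add L T T')
    then show ?case using gen_image_add[of "tensor_elem [] ls T \<phi>" "tensor_elem [] ls T' \<phi>"]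
      by (simp add: tensor_elem_add[abs_def])
  next
    case (scale L T z)
    then show ?case using gen_image_scale[of "tensor_elem [] ls T \<phi>" z]
      by (simp add: tensor_elem_scale[abs_def])
  qed
  have "lower_in_image n \<phi>" for n
  proof (induction n)
    case 0
    then show ?case by (simp add: lower_in_image_def)
  next
    case (Suc n)
    show ?case
      unfolding lower_in_image_def
    proof (intro allI impI)
      fix ls :: "letter list" and T
      assume ls: "length ls < Suc n" "distinct (map snd ls)" "fst ` set ls \<subseteq> {1, 2}" "inv_tensor (snd ` set ls) T"
      have "lower_in_image (length ls) \<phi>"
        by (rule lower_in_image_mono[OF Suc]) (use ls(1) in simp)
      from step[OF ls(4) this ls(2,3) refl] show "tensor_elem [] ls T \<phi> \<in> gen_image" .
    qed
  qed
  from step[OF assms(3) this assms(1,2) refl] show ?thesis .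
qed

section \<open>The image of the weight system\<close>

lemma sum_PiE_insert:
  assumes "k \<notin> A"
  shows "(\<Sum>\<phi>\<in>insert k A \<rightarrow>\<^sub>E I. f \<phi>) = (\<Sum>i\<in>I. \<Sum>\<phi>\<in>A \<rightarrow>\<^sub>E I. f (\<phi>(k := i)))"
proof -
  have "(\<Sum>\<phi>\<in>insert k A \<rightarrow>\<^sub>E I. f \<phi>) = (\<Sum>(i, \<phi>)\<in>I \<times> (A \<rightarrow>\<^sub>E I). f (\<phi>(k := i)))"
    unfolding PiE_insert_eq
    by (subst sum.reindex[OF inj_combinator[OF assms]]) (simp add: case_prod_unfold)
  then show ?thesis by (simp add: sum.cartesian_product)
qed

text \<open>Since T depends only on the labels of the word, the recursion unfolds to one sum over
  extensional assignments, the form in which \<open>w_sl2\<close> is given.\<close>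

lemma tensor_elem_eq_sum:
  assumes "distinct (map snd ls)"
    and "\<And>\<psi> \<psi>'. (\<And>k. k \<in> snd ` set ls \<Longrightarrow> \<psi> k = \<psi>' k) \<Longrightarrow> T \<psi> = T \<psi>'"
  shows "tensor_elem u ls T \<phi> w
    = (\<Sum>\<psi>\<in>snd ` set ls \<rightarrow>\<^sub>E ix. T \<psi> * fa_word (u @ map (\<lambda>p. (fst p, \<psi> (snd p))) ls) w)"
  using assms
proof (induction ls arbitrary: u \<phi> T)
  case Nil
  then show ?case using Nil(2)[of \<phi> "\<lambda>_. undefined"] by simp
next
  case (Cons p ls)
  have p: "snd p \<notin> snd ` set ls" using Cons.prems(1) by simp
  have "tensor_elem (u @ [(fst p, i)]) ls T (\<phi>(snd p := i)) w
    = (\<Sum>\<psi>\<in>snd ` set ls \<rightarrow>\<^sub>E ix. T (\<psi>(snd p := i))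
         * fa_word (u @ (fst p, i) # map (\<lambda>p. (fst p, \<psi> (snd p))) ls) w)" for i
  proof -
    have 1: "tensor_elem (u @ [(fst p, i)]) ls T (\<phi>(snd p := i)) = tensor_elem (u @ [(fst p, i)]) ls (\<lambda>\<psi>. T (\<psi>(snd p := i))) \<phi>"
      by (rule tensor_elem_comp[where h="\<lambda>\<psi>. \<psi>(snd p := i)", symmetric]) (use p in \<open>auto simp: fun_eq_iff\<close>)
    have "tensor_elem (u @ [(fst p, i)]) ls (\<lambda>\<psi>. T (\<psi>(snd p := i))) \<phi> w = (\<Sum>\<psi>\<in>snd ` set ls \<rightarrow>\<^sub>E ix. T (\<psi>(snd p := i))
         * fa_word ((u @ [(fst p, i)]) @ map (\<lambda>p. (fst p, \<psi> (snd p))) ls) w)"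
    proof (rule Cons.IH)
      show "distinct (map snd ls)" using Cons.prems(1) by simp
      fix \<psi> \<psi>' :: "nat \<Rightarrow> nat"
      assume "\<And>k. k \<in> snd ` set ls \<Longrightarrow> \<psi> k = \<psi>' k"
      then show "T (\<psi>(snd p := i)) = T (\<psi>'(snd p := i))" by (intro Cons.prems(2)) auto
    qed
    then show ?thesis by (simp add: 1)
  qed
  moreover have "map (\<lambda>q. (fst q, (\<psi>(snd p := i)) (snd q))) ls = map (\<lambda>q. (fst q, \<psi> (snd q))) ls" for \<psi> :: "nat \<Rightarrow> nat" and i
    using p by (intro map_cong refl) (metis fun_upd_other image_eqI)
  ultimately show ?case
    by (simp add: sum_PiE_insert[OF p] fun_upd_same del: fun_upd_apply map_eq_conv)
qed

text \<open>When the fibres of f are pairs, this is the product of their Kronecker symbols, written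
  as an indicator so that no order of the chords has to be chosen.\<close>

definition chord_tensor :: "nat set \<Rightarrow> (nat \<Rightarrow> 'a) \<Rightarrow> (nat \<Rightarrow> nat) \<Rightarrow> complex" where
  "chord_tensor L f \<psi> = (if \<forall>p\<in>L. \<psi> p \<in> ix \<and> (\<forall>q\<in>L. f p = f q \<longrightarrow> \<psi> p = \<psi> q) then 1 else 0)"

text \<open>Each fibre of f is one chord. Removing it splits off one \<open>delta\<close>, and the
  other fibres keep their two elements.\<close>

lemma inv_tensor_matching:
  assumes "finite L" "\<And>i. i \<in> L \<Longrightarrow> card {j \<in> L. f j = f i} = 2"
  shows "inv_tensor L (chord_tensor L f)"
  using assms
proof (induction L rule: finite_psubset_induct)
  case (psubset L)
  show ?case
  proof (cases "L = {}")
    case True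
    then show ?thesis using inv_tensor.one by (simp add: chord_tensor_def[abs_def])
  next
    case False
    then obtain i where i: "i \<in> L" by blast
    obtain x y where xy: "{j \<in> L. f j = f i} = {x, y}" "x \<noteq> y"
      using psubset.prems[OF i] by (auto simp: card_2_iff)
    have "i \<in> {x, y}" using i unfolding xy(1)[symmetric] by simp
    then obtain j where j: "{j \<in> L. f j = f i} = {i, j}" "i \<noteq> j"
      using xy by (metis doubleton_eq_iff insertE singletonD)
    have jL: "j \<in> L" "f j = f i" using j by auto
    have fib: "f p = f i \<longleftrightarrow> p = i \<or> p = j" if "p \<in> L" for p using j that by auto
    let ?L = "L - {i, j}"
    have "inv_tensor ?L (chord_tensor ?L f)"
    proof (rule psubset.IH)
      show "?L \<subset> L" using i by auto
      fix p assume p: "p \<in> ?L"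
      then have "f p \<noteq> f i" "f p \<noteq> f j" using fib[of p] jL by auto
      then have "{q \<in> ?L. f q = f p} = {q \<in> L. f q = f p}" using jL by auto
      then show "card {q \<in> ?L. f q = f p} = 2" using psubset.prems[of p] p by simp
    qed
    then have "inv_tensor (insert i (insert j ?L)) (\<lambda>\<psi>. delta (\<psi> i) (\<psi> j) * chord_tensor ?L f \<psi>)"
      by (rule inv_tensor.delta) (use j in auto)
    moreover have "insert i (insert j ?L) = L" using i jL by auto
    moreover have "delta (\<psi> i) (\<psi> j) * chord_tensor ?L f \<psi> = chord_tensor L f \<psi>" for \<psi>
    proof -
      have iff: "(\<forall>p\<in>L. \<psi> p \<in> ix \<and> (\<forall>q\<in>L. f p = f q \<longrightarrow> \<psi> p = \<psi> q))
        \<longleftrightarrow> (\<psi> i = \<psi> j \<and> \<psi> i \<in> ix) \<and> (\<forall>p\<in>?L. \<psi> p \<in> ix \<and> (\<forall>q\<in>?L. f p = f q \<longrightarrow> \<psi> p = \<psi> q))"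
        (is "?l \<longleftrightarrow> ?r")
      proof
        assume l: ?l
        have "\<psi> j = \<psi> i" using bspec[OF l jL(1)] i jL(2) by blast
        moreover have "\<psi> i \<in> ix" using l i by blast
        ultimately show ?r using l by simp
      next
        assume r: ?r
        then have ij: "\<psi> i = \<psi> j" "\<psi> i \<in> ix" and ix: "\<And>p. p \<in> ?L \<Longrightarrow> \<psi> p \<in> ix"
          and eq: "\<And>p q. p \<in> ?L \<Longrightarrow> q \<in> ?L \<Longrightarrow> f p = f q \<Longrightarrow> \<psi> p = \<psi> q"
          by blast+
        show ?l
        proof (intro ballI conjI impI)
          fix p assume "p \<in> L"
          then show "\<psi> p \<in> ix" using ij ix[of p] by (cases "p = i"; cases "p = j") simp_all
        next
          fix p q assume pq: "p \<in> L" "q \<in> L" "f p = f q"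
          show "\<psi> p = \<psi> q"
          proof (cases "f p = f i")
            case True
            then have "p \<in> {i, j}" "q \<in> {i, j}" using pq fib[of p] fib[of q] by simp_all
            then show ?thesis using ij(1) by fastforce
          next
            case False
            then have "p \<in> ?L" "q \<in> ?L" using pq fib[of p] fib[of q] by simp_all
            then show ?thesis using eq pq(3) by blast
          qed
        qed
      qed
      have "(if A then 1 else 0) * (if B then 1 else 0) = (if C then 1 else (0 :: complex))"
        if "C \<longleftrightarrow> A \<and> B" for A B C using that by simp
      from this[OF iff] show ?thesis unfolding chord_tensor_def delta_def .
    qed
    ultimately show ?thesis by simp
  qed
qed

text \<open>The labels are positions rather than chords: a chord name occurs twice, but an
  \<open>inv_tensor\<close> uses each label once. Colourings of chords correspond to colourings of
  positions that are constant on chords, which \<open>chord_tensor\<close> selects.\<close>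

lemma w_sl2_eq_tensor_elem:
  fixes S :: "nat list \<times> nat list"
  defines "xs \<equiv> fst S @ snd S"
  defines "st \<equiv> (\<lambda>p. if p < length (fst S) then 1 else 2 :: nat)"
  shows "w_sl2 S = tensor_elem [] (map (\<lambda>p. (st p, p)) [0..<length xs]) (chord_tensor {..<length xs} (\<lambda>p. xs ! p)) \<phi>"
proof
  fix w
  let ?n = "length xs" and ?ls = "map (\<lambda>p. (st p, p)) [0..<length xs]"
  let ?M = "chord_tensor {..<?n} (\<lambda>p. xs ! p)"
  let ?W = "\<lambda>\<psi>. fa_word (map (\<lambda>p. (st p, \<psi> p)) [0..<?n]) w"
  define h where "h \<phi> = restrict (\<lambda>p. \<phi> (xs ! p)) {..<?n}" for \<phi> :: "nat \<Rightarrow> nat"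
  have set: "snd ` set ?ls = {..<?n}" by force
  have "w_sl2 S w = (\<Sum>\<phi>\<in>set xs \<rightarrow>\<^sub>E ix. ?W (h \<phi>))"
  proof -
    have "map (\<lambda>k. (1, \<phi> k)) (fst S) @ map (\<lambda>k. (2, \<phi> k)) (snd S)
        = map (\<lambda>p. (st p, h \<phi> p)) [0..<?n]" for \<phi>
      by (rule nth_equalityI) (auto simp: nth_append xs_def st_def h_def)
    then show ?thesis by (simp add: w_sl2_def xs_def[symmetric] ix_def)
  qed
  also have "\<dots> = sum ?W (h ` (set xs \<rightarrow>\<^sub>E ix))"
  proof (subst sum.reindex)
    show "inj_on h (set xs \<rightarrow>\<^sub>E ix)"
    proof (rule inj_onI)
      fix \<phi> \<phi>' assume 1: "\<phi> \<in> set xs \<rightarrow>\<^sub>E ix" "\<phi>' \<in> set xs \<rightarrow>\<^sub>E ix" "h \<phi> = h \<phi>'"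
      show "\<phi> = \<phi>'"
      proof (rule PiE_ext[OF 1(1,2)])
        fix k assume "k \<in> set xs"
        then obtain p where "p < ?n" "xs ! p = k" by (auto simp: in_set_conv_nth)
        then show "\<phi> k = \<phi>' k" using fun_cong[OF 1(3), of p] by (simp add: h_def)
      qed
    qed
  qed simp
  also have "\<dots> = (\<Sum>\<psi>\<in>h ` (set xs \<rightarrow>\<^sub>E ix). ?M \<psi> * ?W \<psi>)"
  proof (intro sum.cong refl)
    fix \<psi> assume "\<psi> \<in> h ` (set xs \<rightarrow>\<^sub>E ix)"
    then have "?M \<psi> = 1" by (fastforce simp: chord_tensor_def h_def)
    then show "?W \<psi> = ?M \<psi> * ?W \<psi>" by simp
  qed
  also have "\<dots> = (\<Sum>\<psi>\<in>{..<?n} \<rightarrow>\<^sub>E ix. ?M \<psi> * ?W \<psi>)"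
  proof (rule sum.mono_neutral_left)
    show "finite ({..<?n} \<rightarrow>\<^sub>E ix)" by (intro finite_PiE) auto
    show "h ` (set xs \<rightarrow>\<^sub>E ix) \<subseteq> {..<?n} \<rightarrow>\<^sub>E ix"
      by (auto simp: h_def PiE_iff split: if_splits)
    show "\<forall>\<psi>\<in>({..<?n} \<rightarrow>\<^sub>E ix) - h ` (set xs \<rightarrow>\<^sub>E ix). ?M \<psi> * ?W \<psi> = 0"
    proof
      fix \<psi> assume \<psi>: "\<psi> \<in> ({..<?n} \<rightarrow>\<^sub>E ix) - h ` (set xs \<rightarrow>\<^sub>E ix)"
      have "?M \<psi> = 0"
      proof (rule ccontr)
        assume "?M \<psi> \<noteq> 0"
        then have "\<forall>p\<in>{..<?n}. \<psi> p \<in> ix \<and> (\<forall>q\<in>{..<?n}. xs ! p = xs ! q \<longrightarrow> \<psi> p = \<psi> q)"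
          unfolding chord_tensor_def by argo
        then have M: "\<psi> p = \<psi> q" if "p < ?n" "q < ?n" "xs ! p = xs ! q" for p q
          using that by blast
        \<comment> \<open>Either end of the chord k recovers its colour, since \<psi> agrees on
          both.\<close>
        define idx where "idx k = (SOME p. p < ?n \<and> xs ! p = k)" for k
        have idx: "idx k < ?n \<and> xs ! idx k = k" if "k \<in> set xs" for k
          unfolding idx_def by (rule someI_ex) (use that in \<open>auto simp: in_set_conv_nth\<close>)
        let ?\<phi> = "restrict (\<lambda>k. \<psi> (idx k)) (set xs)"
        have P: "?\<phi> \<in> set xs \<rightarrow>\<^sub>E ix" using idx \<psi> by fastforce
        have "h ?\<phi> = \<psi>"
        proof
          fix p
          show "h ?\<phi> p = \<psi> p"
          proof (cases "p < ?n")
            case True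
            then show ?thesis using M[of "idx (xs ! p)" p] idx[of "xs ! p"] by (simp add: h_def)
          next
            case False
            then show ?thesis using \<psi> by (auto simp: h_def PiE_def extensional_def)
          qed
        qed
        then show False using imageI[OF P, of h] \<psi> by simp
      qed
      then show "?M \<psi> * ?W \<psi> = 0" by simp
    qed
  qed
  also have "\<dots> = tensor_elem [] ?ls ?M \<phi> w"
  proof (subst tensor_elem_eq_sum)
    show "distinct (map snd ?ls)" by (simp add: comp_def)
    fix \<psi> \<psi>' :: "nat \<Rightarrow> nat" assume "\<And>k. k \<in> snd ` set ?ls \<Longrightarrow> \<psi> k = \<psi>' k"
    then show "?M \<psi> = ?M \<psi>'" unfolding set by (simp add: chord_tensor_def)
  qed (simp only: set, simp add: comp_def)
  finally show "w_sl2 S w = tensor_elem [] ?ls ?M \<phi> w" .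
qed

lemma w_sl2_gen_image:
  assumes "is_share S"
  shows "w_sl2 S \<in> gen_image"
proof -
  let ?xs = "fst S @ snd S"
  have "card {q \<in> {..<length ?xs}. ?xs ! q = ?xs ! p} = 2" if "p \<in> {..<length ?xs}" for p
  proof -
    have "?xs ! p \<in> set ?xs" using that nth_mem by blast
    then have "count_list ?xs (?xs ! p) = 2" using assms unfolding is_share_def by blast
    moreover have "{q \<in> {..<length ?xs}. ?xs ! q = ?xs ! p} = {q. q < length ?xs \<and> ?xs ! p = ?xs ! q}"
      by auto
    ultimately show ?thesis
      by (simp only: count_list_eq_length_filter length_filter_conv_card)
  qed
  then have inv: "inv_tensor {..<length ?xs} (chord_tensor {..<length ?xs} (\<lambda>p. ?xs ! p))"
    by (intro inv_tensor_matching) auto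
  have set: "snd ` set (map (\<lambda>p. (f p, p)) [0..<n]) = {..<n}" for f :: "nat \<Rightarrow> nat" and n :: nat
    by (simp add: image_image atLeast0LessThan)
  show ?thesis
    unfolding w_sl2_eq_tensor_elem[of S "\<lambda>_. 0"]
  proof (rule tensor_elem_gen_image)
    show "distinct (map snd (map (\<lambda>p. (if p < length (fst S) then 1 else 2, p)) [0..<length ?xs]))"
      by (simp add: comp_def)
    show "fst ` set (map (\<lambda>p. (if p < length (fst S) then 1 else 2, p)) [0..<length ?xs]) \<subseteq> {1, 2}"
      by auto
  qed (unfold set, rule inv)
qed

section \<open>Closure of the image under multiplication by the generators\<close>

lemma in_w_image_induct [consumes 1, case_names uequiv zero add scale share]:
  assumes "in_w_image f"
    and u: "\<And>f g. uequiv f g \<Longrightarrow> P g \<Longrightarrow> P f"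
    and z: "P (\<lambda>w. 0)"
    and a: "\<And>f g. P f \<Longrightarrow> P g \<Longrightarrow> P (\<lambda>w. f w + g w)"
    and s: "\<And>f c. P f \<Longrightarrow> P (\<lambda>w. c * f w)"
    and w: "\<And>S. is_share S \<Longrightarrow> P (w_sl2 S)"
  shows "P f"
proof -
  obtain L :: "(complex \<times> (nat list \<times> nat list)) list" where L: "\<forall>(c, S)\<in>set L. is_share S"
    and f: "uequiv f (\<lambda>w. \<Sum>(c, S)\<leftarrow>L. c * w_sl2 S w)"
    using assms(1) unfolding in_w_image_def by blast
  have "P (\<lambda>w. \<Sum>(c, S)\<leftarrow>L. c * w_sl2 S w)"
    using L
  proof (induction L)
    case Nil
    then show ?case using z by simp
  next
    case (Cons x L)
    then show ?case
      using a[OF s[OF w, of "snd x" "fst x"] Cons.IH] by (simp add: case_prod_unfold)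
  qed
  then show ?thesis using f u by blast
qed

lemma in_w_image_uequiv: "uequiv f g \<Longrightarrow> in_w_image g \<Longrightarrow> in_w_image f"
  unfolding in_w_image_def using uequiv_trans by blast

lemma in_w_image_share: "is_share S \<Longrightarrow> in_w_image (w_sl2 S)"
  unfolding in_w_image_def by (intro exI[of _ "[(1, S)]"]) auto

lemma in_w_image_zero: "in_w_image (\<lambda>w. 0)"
  unfolding in_w_image_def by (intro exI[of _ "[]"]) auto

lemma in_w_image_add:
  assumes "in_w_image f" "in_w_image g"
  shows "in_w_image (\<lambda>w. f w + g w)"
proof -
  obtain L L' :: "(complex \<times> (nat list \<times> nat list)) list" where
    L: "\<forall>(c, S)\<in>set L. is_share S" "uequiv f (\<lambda>w. \<Sum>(c, S)\<leftarrow>L. c * w_sl2 S w)"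
    "\<forall>(c, S)\<in>set L'. is_share S" "uequiv g (\<lambda>w. \<Sum>(c, S)\<leftarrow>L'. c * w_sl2 S w)"
    using assms unfolding in_w_image_def by blast
  then show ?thesis
    unfolding in_w_image_def using uequiv_add[OF L(2,4)] by (intro exI[of _ "L @ L'"]) auto
qed

lemma in_w_image_scale:
  assumes "in_w_image f"
  shows "in_w_image (\<lambda>w. z * f w)"
proof -
  obtain L :: "(complex \<times> (nat list \<times> nat list)) list" where
    L: "\<forall>(c, S)\<in>set L. is_share S" "uequiv f (\<lambda>w. \<Sum>(c, S)\<leftarrow>L. c * w_sl2 S w)"
    using assms unfolding in_w_image_def by blast
  have "(\<Sum>(c, S)\<leftarrow>map (\<lambda>(c, S). (z * c, S)) L. c * w_sl2 S w) = z * (\<Sum>(c, S)\<leftarrow>L. c * w_sl2 S w)" for w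
    by (induction L) (auto simp: algebra_simps)
  then show ?thesis
    unfolding in_w_image_def using uequiv_scale[OF L(2), of z] L(1)
    by (intro exI[of _ "map (\<lambda>(c, S). (z * c, S)) L"]) auto
qed

lemma uequiv_move_letter:
  assumes "set (u @ p # xs @ v) \<subseteq> letters" "\<And>x. x \<in> set xs \<Longrightarrow> fst x \<noteq> fst p"
  shows "uequiv (fa_word (u @ p # xs @ v)) (fa_word (u @ xs @ p # v))"
  using assms
proof (induction xs arbitrary: u)
  case Nil
  then show ?case by simp
next
  case (Cons x xs)
  have "uequiv (fa_word (u @ p # x # (xs @ v))) (fa_word (u @ x # p # (xs @ v)))"
    using uequiv_word_swap[of p x u "xs @ v"] Cons.prems(1) Cons.prems(2)[of x, THEN not_sym] by simp
  also have "uequiv \<dots> (fa_word (u @ x # xs @ p # v))"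
    using Cons.IH[of "u @ [x]"] Cons.prems by auto
  finally show ?case by simp
qed

text \<open>\<open>w_sl2\<close> writes strand 1 before strand 2, so an end prepended on strand 2
  has to cross all letters of strand 1. The relation between strands has no lower term, hence the
  crossing is exact.\<close>

lemma uequiv_commute_words:
  assumes u: "set u \<subseteq> letters"
    and "set (ys @ xs @ v) \<subseteq> letters" "\<And>x y. x \<in> set xs \<Longrightarrow> y \<in> set ys \<Longrightarrow> fst x \<noteq> fst y"
  shows "uequiv (fa_word (u @ ys @ xs @ v)) (fa_word (u @ xs @ ys @ v))"
  using assms(2,3)
proof (induction ys arbitrary: v rule: rev_induct)
  case Nil
  then show ?case by simp
next
  case (snoc y ys)
  have "uequiv (fa_word ((u @ ys) @ y # xs @ v)) (fa_word ((u @ ys) @ xs @ y # v))"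
    by (rule uequiv_move_letter) (use snoc.prems u in auto)
  also have "uequiv \<dots> (fa_word (u @ xs @ ys @ y # v))"
    using snoc.IH[of "y # v"] snoc.prems by auto
  finally show ?case by simp
qed

text \<open>Left multiplication by a generator prepends one chord to the share.\<close>

lemma in_w_image_mult_share:
  assumes S: "is_share S" and h: "h \<in> {cas1, cas2, xel}"
  shows "in_w_image (fa_mult h (w_sl2 S))"
proof -
  let ?A = "set (fst S @ snd S)"
  obtain k where k: "k \<notin> ?A" using ex_new_if_finite[OF infinite_UNIV_nat, of ?A] by auto
  \<comment> \<open>The numbers of ends of the new chord on strands 1 and 2: (2, 0), (0, 2) and (1,
    1) give \<open>cas1\<close>, \<open>cas2\<close> and \<open>xel\<close>, which are thus treated
    together.\<close>
  obtain n m where nm: "n + m = (2 :: nat)"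
    and h': "h = (\<lambda>w. \<Sum>i\<in>ix. fa_word (replicate n (1, i) @ replicate m (2, i)) w)"
  proof -
    have "h = (\<lambda>w. \<Sum>i\<in>ix. fa_word (replicate 2 (1, i) @ replicate 0 (2, i)) w) \<or>
      h = (\<lambda>w. \<Sum>i\<in>ix. fa_word (replicate 0 (1, i) @ replicate 2 (2, i)) w) \<or>
      h = (\<lambda>w. \<Sum>i\<in>ix. fa_word (replicate 1 (1, i) @ replicate 1 (2, i)) w)"
      using h by (auto simp: cas1_def cas2_def xel_def ix_def numeral_2_eq_2)
    then show thesis using that[of 2 0] that[of 0 2] that[of 1 1] by auto
  qed
  let ?S = "(replicate n k @ fst S, replicate m k @ snd S)"
  have cr: "count_list (replicate l k) x = (if x = k then l else 0)" for l x
    by (induction l) auto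
  have "is_share ?S"
    unfolding is_share_def
  proof
    fix x assume x: "x \<in> set (fst ?S @ snd ?S)"
    show "count_list (fst ?S @ snd ?S) x = 2"
    proof (cases "x = k")
      case True
      have "count_list (fst S) k = 0" "count_list (snd S) k = 0"
        using k by (simp_all add: count_list_0_iff)
      then show ?thesis using True nm by (simp add: cr)
    next
      case False
      then have "x \<in> ?A" using x by auto
      then have "count_list (fst S @ snd S) x = 2" using S unfolding is_share_def by blast
      then show ?thesis using False by (simp add: cr)
    qed
  qed
  then have "in_w_image (w_sl2 ?S)" by (rule in_w_image_share)
  moreover have "uequiv (fa_mult h (w_sl2 S)) (w_sl2 ?S)"
  proof -
    let ?P = "\<lambda>\<phi>. map (\<lambda>k. (1 :: nat, \<phi> k)) (fst S)" and ?Q = "\<lambda>\<phi>. map (\<lambda>k. (2 :: nat, \<phi> k)) (snd S)"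
    have 1: "fa_mult h (w_sl2 S) = (\<lambda>w. \<Sum>i\<in>ix. \<Sum>\<phi>\<in>?A \<rightarrow>\<^sub>E ix.
        fa_word (replicate n (1, i) @ replicate m (2, i) @ ?P \<phi> @ ?Q \<phi>) w)"
      unfolding h' w_sl2_def ix_def[symmetric]
      by (simp add: fa_mult_sum_left fa_mult_sum_right fa_mult_word_word)
    have 2: "uequiv (\<lambda>w. \<Sum>i\<in>ix. \<Sum>\<phi>\<in>?A \<rightarrow>\<^sub>E ix.
        fa_word (replicate n (1, i) @ replicate m (2, i) @ ?P \<phi> @ ?Q \<phi>) w)
      (\<lambda>w. \<Sum>i\<in>ix. \<Sum>\<phi>\<in>?A \<rightarrow>\<^sub>E ix.
        fa_word (replicate n (1, i) @ ?P \<phi> @ replicate m (2, i) @ ?Q \<phi>) w)"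
      by (intro uequiv_sum uequiv_commute_words) (fastforce simp: letters_iff)+
    have 3: "(\<lambda>w. \<Sum>i\<in>ix. \<Sum>\<phi>\<in>?A \<rightarrow>\<^sub>E ix.
        fa_word (replicate n (1, i) @ ?P \<phi> @ replicate m (2, i) @ ?Q \<phi>) w) = w_sl2 ?S"
    proof -
      have set: "set (fst ?S @ snd ?S) = insert k ?A" using nm by auto
      have "map (\<lambda>x. (j, (\<phi>(k := i)) x)) (replicate l k @ xs) = replicate l (j, i) @ map (\<lambda>x. (j, \<phi> x)) xs"
        if "set xs \<subseteq> ?A" for j :: nat and i l xs and \<phi> :: "nat \<Rightarrow> nat"
        using that k by (auto simp: map_replicate_const)
      from this[of "fst S" 1] this[of "snd S" 2]
      show ?thesis
        unfolding w_sl2_def ix_def[symmetric] set unfolding sum_PiE_insert[OF k] fst_conv snd_conv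
        by (simp del: map_append fun_upd_apply)
    qed
    from 2 show ?thesis unfolding 1 3 .
  qed
  ultimately show ?thesis using in_w_image_uequiv by blast
qed

lemma in_w_image_mult_generator:
  assumes "in_w_image f" and h: "h \<in> {cas1, cas2, xel}"
  shows "in_w_image (fa_mult h f)"
  using assms(1)
proof (induction rule: in_w_image_induct)
  case (uequiv f g)
  then show ?case using uequiv_mult_generator[OF h] in_w_image_uequiv by blast
next
  case zero
  then show ?case using in_w_image_zero by (simp add: fa_mult_zero_right)
next
  case (add f g)
  then show ?case using in_w_image_add by (simp add: fa_mult_add_right)
next
  case (scale f c)
  then show ?case using in_w_image_scale by (simp add: fa_mult_scale_right)
next
  case (share S)
  then show ?case using in_w_image_mult_share h by blast
qed

text \<open>With f arbitrary, the product case is associativity: the factors act one after the other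
  on the image.\<close>

lemma in_w_image_mult_gen_alg:
  "g \<in> gen_alg \<Longrightarrow> in_w_image f \<Longrightarrow> in_w_image (fa_mult g f)"
proof (induction arbitrary: f rule: gen_alg.induct)
  case (add g g')
  then show ?case using in_w_image_add by (simp add: fa_add_def fa_mult_add_left)
next
  case (smult g c)
  then show ?case using in_w_image_scale by (simp add: fa_smult_def fa_mult_scale_left)
qed (simp_all add: fa_mult_one_left in_w_image_mult_generator fa_mult_assoc)

lemma in_w_image_iff_gen_alg: "in_w_image f \<longleftrightarrow> (\<exists>g\<in>gen_alg. uequiv f g)"
proof
  assume "in_w_image f"
  then have "f \<in> gen_image"
    by (induction rule: in_w_image_induct)
      (auto intro: gen_image_uequiv gen_image_zero gen_image_add gen_image_scale w_sl2_gen_image)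
  then show "\<exists>g\<in>gen_alg. uequiv f g" by (simp add: gen_image_def)
next
  assume "\<exists>g\<in>gen_alg. uequiv f g"
  then obtain g where g: "g \<in> gen_alg" "uequiv f g" by blast
  \<comment> \<open>The share without chords has weight 1, and multiplying it by g returns
    g.\<close>
  have "is_share ([], [])" by (simp add: is_share_def)
  moreover have "w_sl2 ([], []) = fa_word []" by (simp add: w_sl2_def)
  ultimately have "in_w_image (fa_word [])" using in_w_image_share by metis
  then have "in_w_image (fa_mult g (fa_word []))" using g(1) in_w_image_mult_gen_alg by blast
  then show "in_w_image f" using g(2) in_w_image_uequiv by (simp add: fa_mult_one_right)
qed

section \<open>Algebraic independence\<close>

text \<open>The dual Verma module of highest weight l: e acts as the derivative on polynomials, written in
  divided powers, and the basis is x_1 = (e + f)/2, x_2 = -i(e - f)/2, x_3 = h/2. The truncated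
  subtraction at m = 0 is harmless because of the factor m.\<close>

definition verma :: "complex \<Rightarrow> nat \<Rightarrow> (nat \<Rightarrow> complex) \<Rightarrow> nat \<Rightarrow> complex" where
  "verma l a g m =
    (if a = 1 then (g (Suc m) + of_nat m * (l - of_nat m + 1) * g (m - 1)) / 2
     else if a = 2 then - \<i> * (g (Suc m) - of_nat m * (l - of_nat m + 1) * g (m - 1)) / 2
     else if a = 3 then (l - 2 * of_nat m) * g m / 2 else 0)"

lemma verma_commutator:
  assumes "a \<in> ix" "b \<in> ix"
  shows "verma l a (verma l b g) m
    = verma l b (verma l a g) m + (\<Sum>c\<in>ix. sl2_struct a b c * verma l c g m)"
  using assms unfolding sl2_struct_eq
  by (cases m) (auto simp: ix_def verma_def eps_def field_simps)

lemma verma_casimir: "(\<Sum>a\<in>ix. verma l a (verma l a g) m) = l * (l + 2) / 4 * g m"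
  by (cases m) (auto simp: ix_def verma_def field_simps)

section \<open>The action on the tensor product of two modules\<close>

type_synonym vec = "nat \<Rightarrow> nat \<Rightarrow> complex"

text \<open>Vectors are arbitrary coefficient functions, that is, formal power series in two
  variables; a letter reads only finitely many coefficients to produce each new one. Strand 1 acts
  in the first index and strand 2 in the second.\<close>

definition letter_act :: "complex \<Rightarrow> complex \<Rightarrow> letter \<Rightarrow> vec \<Rightarrow> vec" where
  "letter_act l1 l2 p F = (\<lambda>m n.
    if fst p = 1 then verma l1 (snd p) (\<lambda>m'. F m' n) m else verma l2 (snd p) (F m) n)"

definition word_act :: "complex \<Rightarrow> complex \<Rightarrow> letter list \<Rightarrow> vec \<Rightarrow> vec" where
  "word_act l1 l2 w F = foldr (letter_act l1 l2) w F"

lemma word_act_simps [simp]: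
  "word_act l1 l2 [] F = F" "word_act l1 l2 (p # w) F = letter_act l1 l2 p (word_act l1 l2 w F)"
  "word_act l1 l2 (u @ w) F = word_act l1 l2 u (word_act l1 l2 w F)"
  by (simp_all add: word_act_def)

lemma letter_act_add: "letter_act l1 l2 p (\<lambda>m n. F m n + G m n) = (\<lambda>m n. letter_act l1 l2 p F m n + letter_act l1 l2 p G m n)"
  by (intro ext) (simp add: letter_act_def verma_def field_simps)

lemma letter_act_scale: "letter_act l1 l2 p (\<lambda>m n. z * F m n) = (\<lambda>m n. z * letter_act l1 l2 p F m n)"
  by (intro ext) (simp add: letter_act_def verma_def field_simps)

lemma word_act_add: "word_act l1 l2 u (\<lambda>m n. F m n + G m n) = (\<lambda>m n. word_act l1 l2 u F m n + word_act l1 l2 u G m n)"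
  by (induction u) (simp_all add: letter_act_add)

lemma word_act_scale: "word_act l1 l2 u (\<lambda>m n. z * F m n) = (\<lambda>m n. z * word_act l1 l2 u F m n)"
  by (induction u) (simp_all add: letter_act_scale)

lemma word_act_sum: "word_act l1 l2 u (\<lambda>m n. \<Sum>i\<in>A. F i m n) = (\<lambda>m n. \<Sum>i\<in>A. word_act l1 l2 u (F i) m n)"
proof (induction A rule: infinite_finite_induct)
  case (insert i A)
  then show ?case by (simp add: word_act_add)
qed (use word_act_scale[of l1 l2 u 0] in simp_all)

text \<open>The defining relations hold in the module: on one strand by
  \<open>verma_commutator\<close>, across strands because the operators work in different
  indices.\<close>

lemma letter_act_swap:
  assumes "p \<in> letters" "q \<in> letters"
  shows "letter_act l1 l2 p (letter_act l1 l2 q F) = (\<lambda>m n. letter_act l1 l2 q (letter_act l1 l2 p F) m n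
     + (if fst p = fst q then \<Sum>c\<in>ix. sl2_struct (snd p) (snd q) c * letter_act l1 l2 (fst p, c) F m n else 0))"
proof (intro ext)
  fix m n
  obtain j a k b where pq: "p = (j, a)" "q = (k, b)" "j \<in> {1, 2}" "k \<in> {1, 2}" "a \<in> ix" "b \<in> ix"
    using assms by (cases p; cases q) (auto simp: letters_iff)
  show "letter_act l1 l2 p (letter_act l1 l2 q F) m n = letter_act l1 l2 q (letter_act l1 l2 p F) m n
     + (if fst p = fst q then \<Sum>c\<in>ix. sl2_struct (snd p) (snd q) c * letter_act l1 l2 (fst p, c) F m n else 0)"
  proof (cases "j = k")
    case True
    then show ?thesis using pq verma_commutator[OF pq(5,6)] by (auto simp: letter_act_def)
  next
    case False
    then show ?thesis using pq by (auto simp: letter_act_def verma_def ix_def field_simps)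
  qed
qed

text \<open>For infinite support the sum has the default value 0, which is why the linearity and
  product rules are stated under \<open>fin_supp\<close>.\<close>

definition alg_act :: "complex \<Rightarrow> complex \<Rightarrow> felem \<Rightarrow> vec \<Rightarrow> vec" where
  "alg_act l1 l2 f F = (\<lambda>m n. \<Sum>w | f w \<noteq> 0. f w * word_act l1 l2 w F m n)"

definition fin_supp :: "felem \<Rightarrow> bool" where
  "fin_supp f \<longleftrightarrow> finite {w. f w \<noteq> 0}"

lemma alg_act_eq_sum:
  assumes "finite A" "{w. f w \<noteq> 0} \<subseteq> A"
  shows "alg_act l1 l2 f F m n = (\<Sum>w\<in>A. f w * word_act l1 l2 w F m n)"
  unfolding alg_act_def by (rule sum.mono_neutral_left) (use assms in auto)

lemma fin_supp_sum: 
  assumes "finite A" "\<And>i. i \<in> A \<Longrightarrow> fin_supp (f i)"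
  shows "fin_supp (\<lambda>w. \<Sum>i\<in>A. c i * f i w)"
proof -
  have "{w. (\<Sum>i\<in>A. c i * f i w) \<noteq> 0} \<subseteq> (\<Union>i\<in>A. {w. f i w \<noteq> 0})"
    by (auto dest: sum.not_neutral_contains_not_neutral)
  then show ?thesis using assms unfolding fin_supp_def
    by (metis (no_types, lifting) finite_UN_I finite_subset)
qed

lemma alg_act_sum:
  assumes "finite A" "\<And>i. i \<in> A \<Longrightarrow> fin_supp (f i)"
  shows "alg_act l1 l2 (\<lambda>w. \<Sum>i\<in>A. c i * f i w) F m n = (\<Sum>i\<in>A. c i * alg_act l1 l2 (f i) F m n)"
proof -
  let ?B = "\<Union>i\<in>A. {w. f i w \<noteq> 0}"
  have B: "finite ?B" using assms by (auto simp: fin_supp_def)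
  have "alg_act l1 l2 (\<lambda>w. \<Sum>i\<in>A. c i * f i w) F m n = (\<Sum>w\<in>?B. (\<Sum>i\<in>A. c i * f i w) * word_act l1 l2 w F m n)"
    by (rule alg_act_eq_sum[OF B]) (auto dest: sum.not_neutral_contains_not_neutral)
  also have "\<dots> = (\<Sum>i\<in>A. c i * (\<Sum>w\<in>?B. f i w * word_act l1 l2 w F m n))"
    by (simp add: sum_distrib_left sum_distrib_right mult.assoc sum.swap[of _ A])
  also have "\<dots> = (\<Sum>i\<in>A. c i * alg_act l1 l2 (f i) F m n)"
    by (intro sum.cong refl arg_cong2[where f="(*)"] alg_act_eq_sum[OF B, symmetric]) auto
  finally show ?thesis .
qed

lemma fin_supp_word: "fin_supp (fa_word u)"
  by (simp add: fin_supp_def fa_word_def)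

lemma alg_act_word: "alg_act l1 l2 (fa_word u) F = word_act l1 l2 u F"
  by (intro ext) (subst alg_act_eq_sum[of "{u}"], auto simp: fa_word_def)

lemma fin_supp_expand: "fin_supp f \<Longrightarrow> f = (\<lambda>w. \<Sum>u | f u \<noteq> 0. f u * fa_word u w)"
proof
  fix w
  assume "fin_supp f"
  then show "f w = (\<Sum>u | f u \<noteq> 0. f u * fa_word u w)"
    by (simp add: fa_word_def fin_supp_def if_distrib[of "\<lambda>x. _ * x"] sum.delta' cong: if_cong)
qed

lemma fin_supp_zero: "fin_supp (\<lambda>w. 0)"
  by (simp add: fin_supp_def)

lemma alg_act_zero: "alg_act l1 l2 (\<lambda>w. 0) F m n = 0"
  by (simp add: alg_act_def)

lemma
  assumes "fin_supp f" "fin_supp g"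
  shows fin_supp_add: "fin_supp (\<lambda>w. f w + g w)"
    and alg_act_add: "alg_act l1 l2 (\<lambda>w. f w + g w) F m n = alg_act l1 l2 f F m n + alg_act l1 l2 g F m n"
  \<comment> \<open>Two summands form a family indexed by \<open>bool\<close>, so the lemmas on
    finite sums apply.\<close>
  using fin_supp_sum[of "UNIV :: bool set" "\<lambda>b. if b then f else g" "\<lambda>_. 1"]
    alg_act_sum[of "UNIV :: bool set" "\<lambda>b. if b then f else g" l1 l2 "\<lambda>_. 1" F m n] assms
  by (simp_all add: UNIV_bool add.commute)

lemma
  assumes "fin_supp f"
  shows fin_supp_scale: "fin_supp (\<lambda>w. z * f w)"
    and alg_act_scale: "alg_act l1 l2 (\<lambda>w. z * f w) F m n = z * alg_act l1 l2 f F m n"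
  using fin_supp_sum[of "{()}" "\<lambda>_. f" "\<lambda>_. z"] alg_act_sum[of "{()}" "\<lambda>_. f" l1 l2 "\<lambda>_. z" F m n] assms
  by simp_all

text \<open>Finite support lets both factors be expanded into words, where multiplication is
  concatenation and the action is composition.\<close>

lemma
  assumes "fin_supp f" "fin_supp g"
  shows fin_supp_mult: "fin_supp (fa_mult f g)"
    and alg_act_mult: "alg_act l1 l2 (fa_mult f g) F = alg_act l1 l2 f (alg_act l1 l2 g F)"
proof -
  let ?A = "{w. f w \<noteq> 0} \<times> {w. g w \<noteq> 0}"
  have A: "finite ?A" using assms by (simp add: fin_supp_def)
  have "fa_mult f g = fa_mult (\<lambda>w. \<Sum>u | f u \<noteq> 0. f u * fa_word u w) (\<lambda>w. \<Sum>u | g u \<noteq> 0. g u * fa_word u w)"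
    using fin_supp_expand[OF assms(1)] fin_supp_expand[OF assms(2)] by (metis (no_types, lifting))
  also have "\<dots> = (\<lambda>w. \<Sum>(u, v)\<in>?A. f u * g v * fa_word (u @ v) w)"
    by (simp add: fa_mult_sum_left fa_mult_sum_right fa_mult_scale_left fa_mult_scale_right
        fa_mult_word_word sum.cartesian_product sum_distrib_left mult.assoc)
  finally have eq: "fa_mult f g = (\<lambda>w. \<Sum>i\<in>?A. (f (fst i) * g (snd i)) * fa_word (fst i @ snd i) w)"
    by (simp add: case_prod_unfold)
  show "fin_supp (fa_mult f g)"
    unfolding eq by (intro fin_supp_sum A fin_supp_word)
  show "alg_act l1 l2 (fa_mult f g) F = alg_act l1 l2 f (alg_act l1 l2 g F)"
  proof (intro ext)
    fix m n
    have "alg_act l1 l2 (fa_mult f g) F m n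
      = (\<Sum>i\<in>?A. f (fst i) * g (snd i) * word_act l1 l2 (fst i) (word_act l1 l2 (snd i) F) m n)"
      unfolding eq by (subst alg_act_sum[OF A]) (simp_all add: fin_supp_word alg_act_word)
    also have "\<dots> = (\<Sum>u | f u \<noteq> 0. f u * (\<Sum>v | g v \<noteq> 0. g v * word_act l1 l2 u (word_act l1 l2 v F) m n))"
      by (simp add: sum_distrib_left sum.cartesian_product case_prod_unfold mult.assoc)
    also have "\<dots> = alg_act l1 l2 f (alg_act l1 l2 g F) m n"
      by (simp add: alg_act_def word_act_sum word_act_scale)
    finally show "alg_act l1 l2 (fa_mult f g) F m n = alg_act l1 l2 f (alg_act l1 l2 g F) m n" .
  qed
qed

text \<open>A relation acts by zero on every vector, also on the one produced by the word to its
  right, and the word to its left maps zero to zero. Finite support is carried along because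
  additivity of the action depends on it.\<close>

lemma U_ideal_acts_trivially:
  assumes "f \<in> U_ideal"
  shows "fin_supp f \<and> alg_act l1 l2 f F m n = 0"
  using assms
proof induction
  case zero
  then show ?case by (simp add: fa_zero_def fin_supp_zero alg_act_zero)
next
  case (gen p q u v)
  have rel: "U_rel p q = (\<lambda>w. fa_word [p, q] w + (-1) * (fa_word [q, p] w
      + (if fst p = fst q then 1 else 0) * (\<Sum>c\<in>ix. sl2_struct (snd p) (snd q) c * fa_word [(fst p, c)] w)))"
    by (rule ext) (simp add: U_rel_def ix_def)
  have fin: "fin_supp (U_rel p q)"
    unfolding rel by (intro fin_supp_add fin_supp_scale fin_supp_sum fin_supp_word finite_ix)
  have "alg_act l1 l2 (U_rel p q) G = (\<lambda>m n. 0)" for G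
    unfolding rel
    by (intro ext, simp only: alg_act_add alg_act_scale alg_act_sum fin_supp_add fin_supp_scale fin_supp_sum fin_supp_word alg_act_word finite_ix)
      (simp add: letter_act_swap[OF gen(1,2)])
  then show ?case
    using word_act_scale[of l1 l2 u 0]
      by (simp add: alg_act_mult fin_supp_mult fin fin_supp_word alg_act_word)
next
  case (add f g)
  then show ?case by (simp add: fa_add_def fin_supp_add alg_act_add)
next
  case (smult f c)
  then show ?case by (simp add: fa_smult_def fin_supp_scale alg_act_scale)
qed

lemma alg_act_scale_vec: "alg_act l1 l2 f (\<lambda>m n. z * F m n) = (\<lambda>m n. z * alg_act l1 l2 f F m n)"
  by (intro ext) (simp add: alg_act_def word_act_scale sum_distrib_left mult.left_commute)

lemma
  assumes "fin_supp h"
  shows fin_supp_pow: "fin_supp (fa_pow h a)"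
    and alg_act_pow: "alg_act l1 l2 h F = (\<lambda>m n. z * F m n)
      \<Longrightarrow> alg_act l1 l2 (fa_pow h a) F = (\<lambda>m n. z ^ a * F m n)"
proof -
  show fin: "fin_supp (fa_pow h a)" for a
    by (induction a) (simp_all add: fin_supp_word fin_supp_mult assms)
  assume *: "alg_act l1 l2 h F = (\<lambda>m n. z * F m n)"
  show "alg_act l1 l2 (fa_pow h a) F = (\<lambda>m n. z ^ a * F m n)"
    by (induction a) (simp_all add: alg_act_word alg_act_mult fin assms alg_act_scale_vec * mult.left_commute mult.assoc)
qed

text \<open>Up to scaling, the polynomial (z_1 - z_2)^k in divided powers: it is killed by e acting
  diagonally, so the Casimir element of the diagonal subalgebra acts on it by a scalar.\<close>

definition eigvec :: "nat \<Rightarrow> vec" where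
  "eigvec k m n = (if m + n = k then (-1) ^ n else 0)"

text \<open>The diagonal Casimir element is c_1 + c_2 + 2x, and \<open>eigvec k\<close> has diagonal
  weight s = l1 + l2 - 2k. So this is half of s(s+2)/4 - l1(l1+2)/4 - l2(l2+2)/4.\<close>

definition xval :: "complex \<Rightarrow> complex \<Rightarrow> nat \<Rightarrow> complex" where
  "xval l1 l2 k = l1 * l2 / 4 - of_nat k * (l1 + l2) / 2 + of_nat k * (of_nat k - 1) / 2"

lemma alg_act_quadratic:
  assumes "h = (\<lambda>w. \<Sum>i\<in>{1,2,3}. fa_word [(j, i), (k, i)] w)"
  shows "fin_supp h" "alg_act l1 l2 h F m n = (\<Sum>i\<in>ix. letter_act l1 l2 (j, i) (letter_act l1 l2 (k, i) F) m n)"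
proof -
  have h: "h = (\<lambda>w. \<Sum>i\<in>ix. 1 * fa_word [(j, i), (k, i)] w)" by (simp add: assms ix_def)
  show "fin_supp h" unfolding h by (intro fin_supp_sum fin_supp_word finite_ix)
  show "alg_act l1 l2 h F m n = (\<Sum>i\<in>ix. letter_act l1 l2 (j, i) (letter_act l1 l2 (k, i) F) m n)"
    unfolding h by (subst alg_act_sum) (simp_all add: fin_supp_word alg_act_word)
qed

lemma alg_act_cas1: "alg_act l1 l2 cas1 F = (\<lambda>m n. l1 * (l1 + 2) / 4 * F m n)"
  by (intro ext) (simp add: alg_act_quadratic[OF cas1_def] letter_act_def verma_casimir)

lemma alg_act_cas2: "alg_act l1 l2 cas2 F = (\<lambda>m n. l2 * (l2 + 2) / 4 * F m n)"
  by (intro ext) (simp add: alg_act_quadratic[OF cas2_def] letter_act_def verma_casimir)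

lemma alg_act_xel: "alg_act l1 l2 xel (eigvec k) = (\<lambda>m n. xval l1 l2 k * eigvec k m n)"
proof (intro ext)
  fix m n
  \<comment> \<open>In terms of e, f and h, x is (e \<otimes> f + f \<otimes> e)/2 + (h \<otimes>
    h)/4.\<close>
  have "alg_act l1 l2 xel (eigvec k) m n
     = (of_nat n * (l2 - of_nat n + 1) * eigvec k (Suc m) (n - 1)
        + of_nat m * (l1 - of_nat m + 1) * eigvec k (m - 1) (Suc n)) / 2
       + (l1 - 2 * of_nat m) * (l2 - 2 * of_nat n) * eigvec k m n / 4"
    by (simp add: alg_act_quadratic[OF xel_def] letter_act_def verma_def ix_def field_simps)
  \<comment> \<open>Moving one degree between the variables flips the sign of \<open>eigvec\<close>.
    At n = 0, where n - 1 is truncated, the prefactor is zero.\<close>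
  also have "of_nat n * (l2 - of_nat n + 1) * eigvec k (Suc m) (n - 1)
      = - of_nat n * (l2 - of_nat n + 1) * eigvec k m n"
    by (cases n) (auto simp: eigvec_def algebra_simps)
  also have "of_nat m * (l1 - of_nat m + 1) * eigvec k (m - 1) (Suc n)
      = - of_nat m * (l1 - of_nat m + 1) * eigvec k m n"
    by (cases m) (auto simp: eigvec_def algebra_simps)
  also have "(- of_nat n * (l2 - of_nat n + 1) * eigvec k m n
        + - of_nat m * (l1 - of_nat m + 1) * eigvec k m n) / 2
       + (l1 - 2 * of_nat m) * (l2 - 2 * of_nat n) * eigvec k m n / 4 = xval l1 l2 k * eigvec k m n"
    by (auto simp: eigvec_def xval_def field_simps)
  finally show "alg_act l1 l2 xel (eigvec k) m n = xval l1 l2 k * eigvec k m n" .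
qed

lemma
  shows fin_supp_monom3: "fin_supp (monom3 (a, b, c))"
    and alg_act_monom3: "alg_act l1 l2 (monom3 (a, b, c)) (eigvec k)
      = (\<lambda>m n. (l1 * (l1 + 2) / 4) ^ a * (l2 * (l2 + 2) / 4) ^ b * xval l1 l2 k ^ c * eigvec k m n)"
proof -
  note fin = alg_act_quadratic(1)[OF cas1_def] alg_act_quadratic(1)[OF cas2_def] alg_act_quadratic(1)[OF xel_def]
  show "fin_supp (monom3 (a, b, c))" by (simp add: monom3_def fin_supp_mult fin_supp_pow fin)
  show "alg_act l1 l2 (monom3 (a, b, c)) (eigvec k)
      = (\<lambda>m n. (l1 * (l1 + 2) / 4) ^ a * (l2 * (l2 + 2) / 4) ^ b * xval l1 l2 k ^ c * eigvec k m n)"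
    by (simp add: monom3_def alg_act_mult fin_supp_mult fin_supp_pow fin alg_act_pow[OF fin(3) alg_act_xel]
        alg_act_pow[OF fin(1) alg_act_cas1] alg_act_pow[OF fin(2) alg_act_cas2] mult.assoc)
qed

section \<open>Eigenvalues and the vanishing of polynomials in three variables\<close>

lemma infinite_xval: "infinite (range (xval l1 l2))"
proof
  assume "finite (range (xval l1 l2))"
  then obtain k0 where "infinite {k. xval l1 l2 k = xval l1 l2 k0}"
    using pigeonhole_infinite[of UNIV "xval l1 l2"] by auto
  moreover have "finite {k. xval l1 l2 k = xval l1 l2 k0}"
  proof -
    \<comment> \<open>The coefficients of \<open>xval l1 l2 k - xval l1 l2 k0\<close> as a
      polynomial in k. The leading one is 1/2 for all weights, so each value is taken only finitely
      often.\<close>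
    let ?c = "\<lambda>i. if i = 0 then l1 * l2 / 4 - xval l1 l2 k0 else if i = 1 then - (l1 + l2 + 1) / 2 else 1 / 2"
    have "{k. xval l1 l2 k = xval l1 l2 k0} \<subseteq> of_nat -` {x. (\<Sum>i\<le>2. ?c i * x ^ i) = 0}"
    proof -
      have "(\<Sum>i\<le>2. ?c i * of_nat k ^ i) = xval l1 l2 k - xval l1 l2 k0" for k
        by (simp add: xval_def[of l1 l2 k] numeral_2_eq_2 field_simps)
      then show ?thesis by simp
    qed
    moreover have "finite {x :: complex. (\<Sum>i\<le>2. ?c i * x ^ i) = 0}"
      unfolding polyfun_finite_roots by (intro exI[of _ 2]) simp
    then have "finite (of_nat -` {x :: complex. (\<Sum>i\<le>2. ?c i * x ^ i) = 0} :: nat set)"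
      by (rule finite_vimageI) (simp add: inj_of_nat)
    ultimately show ?thesis by (rule finite_subset)
  qed
  ultimately show False by simp
qed

lemma casimir_value_surj: "\<exists>l :: complex. l * (l + 2) / 4 = x"
proof
  \<comment> \<open>Completing the square turns the equation into (l + 1)^2 = 1 + 4x.\<close>
  show "(csqrt (1 + 4 * x) - 1) * ((csqrt (1 + 4 * x) - 1) + 2) / 4 = x"
    using power2_csqrt[of "1 + 4 * x"] by (simp add: power2_eq_square field_simps)
qed

text \<open>The set Z may depend on x and y, as the eigenvalues of \<open>xel\<close> depend on the
  weights. Hence z is eliminated first, with x and y fixed; y and x then range over all complex
  numbers.\<close>

lemma polyfun3_eq_0:
  fixes q :: "nat \<Rightarrow> nat \<Rightarrow> nat \<Rightarrow> complex"
  assumes "\<And>x y. \<exists>Z. infinite Z \<and> (\<forall>z\<in>Z. (\<Sum>a\<le>N. \<Sum>b\<le>N. \<Sum>c\<le>N. q a b c * x ^ a * y ^ b * z ^ c) = 0)"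
    and "a \<le> N" "b \<le> N" "c \<le> N"
  shows "q a b c = 0"
proof -
  have 1: "(\<Sum>b\<le>N. (\<Sum>a\<le>N. q a b c * x ^ a) * y ^ b) = 0" for x y
  proof -
    obtain Z where Z: "infinite Z" "\<And>z. z \<in> Z \<Longrightarrow> (\<Sum>a\<le>N. \<Sum>b\<le>N. \<Sum>c\<le>N. q a b c * x ^ a * y ^ b * z ^ c) = 0"
      using assms(1) by blast
    have "(\<Sum>a\<le>N. \<Sum>b\<le>N. \<Sum>c\<le>N. q a b c * x ^ a * y ^ b * z ^ c)
       = (\<Sum>c\<le>N. (\<Sum>b\<le>N. (\<Sum>a\<le>N. q a b c * x ^ a) * y ^ b) * z ^ c)" for z
    proof -
      have "(\<Sum>a\<le>N. \<Sum>b\<le>N. \<Sum>c\<le>N. q a b c * x ^ a * y ^ b * z ^ c)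
        = (\<Sum>b\<le>N. \<Sum>a\<le>N. \<Sum>c\<le>N. q a b c * x ^ a * y ^ b * z ^ c)" by (rule sum.swap)
      also have "\<dots> = (\<Sum>b\<le>N. \<Sum>c\<le>N. \<Sum>a\<le>N. q a b c * x ^ a * y ^ b * z ^ c)"
        by (intro sum.cong refl sum.swap)
      also have "\<dots> = (\<Sum>c\<le>N. \<Sum>b\<le>N. \<Sum>a\<le>N. q a b c * x ^ a * y ^ b * z ^ c)"
        by (rule sum.swap)
      finally show ?thesis by (simp add: sum_distrib_right)
    qed
    with Z have "Z \<subseteq> {z. (\<Sum>c\<le>N. (\<Sum>b\<le>N. (\<Sum>a\<le>N. q a b c * x ^ a) * y ^ b) * z ^ c) = 0}"
      by auto
    with Z(1) have "infinite {z. (\<Sum>c\<le>N. (\<Sum>b\<le>N. (\<Sum>a\<le>N. q a b c * x ^ a) * y ^ b) * z ^ c) = 0}"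
      using finite_subset by blast
    then show ?thesis unfolding polyfun_finite_roots using assms(4) by blast
  qed
  then have "(\<Sum>a\<le>N. q a b c * x ^ a) = 0" for x
    using polyfun_eq_0[of "\<lambda>b. \<Sum>a\<le>N. q a b c * x ^ a" N] assms(3) by simp
  then show ?thesis using polyfun_eq_0[of "\<lambda>a. q a b c" N] assms(2) by simp
qed

lemma algebraically_independent:
  fixes p :: "nat \<times> nat \<times> nat \<Rightarrow> complex"
  assumes fin: "finite {m. p m \<noteq> 0}" and zero: "uequiv (eval3 p) fa_zero"
  shows "p = (\<lambda>_. 0)"
proof -
  let ?M = "{m. p m \<noteq> 0}"
  obtain N where N: "?M \<subseteq> {..N} \<times> {..N} \<times> {..N}"
  proof -
    have "finite (fst ` ?M \<union> (fst \<circ> snd) ` ?M \<union> (snd \<circ> snd) ` ?M)" using fin by simp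
    then obtain N where "\<forall>n\<in>fst ` ?M \<union> (fst \<circ> snd) ` ?M \<union> (snd \<circ> snd) ` ?M. n \<le> N"
      unfolding finite_nat_set_iff_bounded_le by blast
    then have "?M \<subseteq> {..N} \<times> {..N} \<times> {..N}" by (force simp: mem_Times_iff)
    then show thesis by (rule that)
  qed
  have vanish: "(\<Sum>a\<le>N. \<Sum>b\<le>N. \<Sum>c\<le>N. p (a, b, c) * (l1 * (l1 + 2) / 4) ^ a * (l2 * (l2 + 2) / 4) ^ b
      * xval l1 l2 k ^ c) = 0" for l1 l2 k
  proof -
    let ?v = "\<lambda>(a, b, c). (l1 * (l1 + 2) / 4) ^ a * (l2 * (l2 + 2) / 4) ^ b * xval l1 l2 k ^ c"
    have "eval3 p \<in> U_ideal" using zero by (simp add: uequiv_def fa_zero_def)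
    \<comment> \<open>The coordinate (k, 0) of \<open>eigvec k\<close> is 1, so evaluating there
      reads off the eigenvalue.\<close>
    then have "alg_act l1 l2 (eval3 p) (eigvec k) k 0 = 0" using U_ideal_acts_trivially by blast
    moreover have "alg_act l1 l2 (eval3 p) (eigvec k) k 0 = (\<Sum>m\<in>?M. p m * alg_act l1 l2 (monom3 m) (eigvec k) k 0)"
      unfolding eval3_def by (rule alg_act_sum[OF fin]) (auto simp: fin_supp_monom3 split: prod.splits)
    moreover have "alg_act l1 l2 (monom3 m) (eigvec k) k 0 = ?v m" for m
      by (cases m) (simp add: alg_act_monom3 eigvec_def)
    ultimately have "(\<Sum>m\<in>?M. p m * ?v m) = 0" by simp
    also have "(\<Sum>m\<in>?M. p m * ?v m) = (\<Sum>m\<in>{..N} \<times> {..N} \<times> {..N}. p m * ?v m)"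
      by (rule sum.mono_neutral_left) (use N in auto)
    finally show ?thesis by (simp add: sum.cartesian_product case_prod_unfold mult.assoc)
  qed
  have "p (a, b, c) = 0" if abc: "a \<le> N" "b \<le> N" "c \<le> N" for a b c
  proof (rule polyfun3_eq_0[where q="\<lambda>a b c. p (a, b, c)", OF _ abc])
    fix x y :: complex
    obtain l1 l2 where "l1 * (l1 + 2) / 4 = x" "l2 * (l2 + 2) / 4 = y" using casimir_value_surj by metis
    then show "\<exists>Z. infinite Z \<and> (\<forall>z\<in>Z. (\<Sum>a\<le>N. \<Sum>b\<le>N. \<Sum>c\<le>N. p (a, b, c) * x ^ a * y ^ b * z ^ c) = 0)"
      using vanish[of l1 l2] infinite_xval[of l1 l2] by (intro exI[of _ "range (xval l1 l2)"]) auto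
  qed
  then have "p m = 0" for m
    using N by (cases m) (metis (mono_tags, lifting) SigmaD1 SigmaD2 atMost_iff mem_Collect_eq subsetD)
  then show ?thesis by (rule ext)
qed

theorem theorem2:
  shows "(\<forall>f. in_w_image f \<longleftrightarrow> (\<exists>g \<in> gen_alg. uequiv f g))
       \<and> (\<forall>p :: nat \<times> nat \<times> nat \<Rightarrow> complex.
            finite {m. p m \<noteq> 0} \<longrightarrow> uequiv (eval3 p) fa_zero \<longrightarrow> p = (\<lambda>_. 0))"
  using in_w_image_iff_gen_alg algebraically_independent by blast

end
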